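(* For every integer $n\geq 0$, there exist a locally profinite set $U$ of cardinality $\aleph_{2n+1}$ and classes $\eta_{0},\ldots,\eta_{n}\in H^{1}(U;\mathbf{F}_{2})$ such that the cup product $\eta_{0}\cdots\eta_{n}\in H^{n+1}(U;\mathbf{F}_{2})$ is nonzero.
   Context: A profinite set is a totally disconnected compact Hausdorff space. A locally profinite set is a topological space obtained by removing one point from a profinite set. $H^{*}(U;\mathbf{F}_{2})$ denotes sheaf cohomology with coefficients in the constant sheaf $\mathbf{F}_{2}$, with its cup product. *)

theory Defs
  imports "HOL-Analysis.Analysis" "HOL-Library.Z2"
begin

unbundle cardinal_syntax

section \<open>Cardinality \<open>\<aleph>\<^sub>k\<close>\<close>

text \<open>
  \<^const>\<open>cardSuc\<close> changes the underlying type, so it cannot be iterated \<open>k\<close> times for a variable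
  \<open>k\<close>. Instead, ``\<open>A\<close> has cardinality \<open>\<aleph>\<^sub>k\<close>'' is a predicate on sets: \<open>A\<close> has cardinality
  \<open>\<aleph>\<^sub>k\<^sub>+\<^sub>1\<close> iff its cardinality is the successor of that of a subset of cardinality \<open>\<aleph>\<^sub>k\<close>.
\<close>

primrec has_aleph :: "nat \<Rightarrow> 'a set \<Rightarrow> bool" where
  "has_aleph 0 A \<longleftrightarrow> |A| =o natLeq"
| "has_aleph (Suc k) A \<longleftrightarrow> (\<exists>B\<subseteq>A. has_aleph k B \<and> |A| =o cardSuc |B| )"

text \<open>
  No single HOL type provably has subsets of cardinality \<open>\<aleph>\<^sub>k\<close> for all \<open>k\<close>. For each individual
  \<open>k\<close> such a type does exist, as the following two facts show.
\<close>

lemma has_aleph_UNIV_nat: "has_aleph 0 (UNIV :: nat set)"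
  by (simp add: card_of_nat)

lemma has_aleph_inj_image:
  assumes "has_aleph k A" "inj_on f A"
  shows "has_aleph k (f ` A)"
  using assms
proof (induction k arbitrary: A)
  case 0
  then have "|f ` A| =o |A|"
    using card_of_ordIso[of A "f ` A"] inj_on_imp_bij_betw ordIso_symmetric by blast
  with 0 show ?case
    using ordIso_transitive by auto
next
  case (Suc k)
  then obtain B where B: "B \<subseteq> A" "has_aleph k B" "|A| =o cardSuc |B|"
    by auto
  have iso: "|f ` A| =o |A|" "|f ` B| =o |B|"
    using Suc.prems(2) B(1) inj_on_imp_bij_betw inj_on_subset card_of_ordIso ordIso_symmetric
    by meson+
  have "|f ` A| =o cardSuc |f ` B|"
    using iso B(3) cardSuc_invar_ordIso[OF card_of_Card_order card_of_Card_order]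
      ordIso_transitive ordIso_symmetric by meson
  moreover have "has_aleph k (f ` B)"
    using Suc.IH B(1,2) Suc.prems(2) inj_on_subset by blast
  ultimately show ?case
    using image_mono[OF B(1), of f] by (auto simp only: has_aleph.simps)
qed

lemma has_aleph_Suc_exists:
  assumes "has_aleph k (A :: 'a set)"
  shows "\<exists>A' :: 'a set set. has_aleph (Suc k) A'"
proof -
  let ?B = "(\<lambda>a. {a}) ` A"
  have B: "has_aleph k ?B"
    using assms by (rule has_aleph_inj_image) (simp add: inj_on_def)
  have iso: "|A| =o |?B|"
    using inj_on_imp_bij_betw[of "\<lambda>a. {a}" A] card_of_ordIso[of A ?B]
    by (auto simp: inj_on_def)
  let ?C = "Field (cardSuc |A| )"
  have C: "|?C| =o cardSuc |A|"
    by (simp add: card_of_Field_ordIso cardSuc_Card_order card_of_Card_order)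
  have CB: "|?C| =o cardSuc |?B|"
    using C iso cardSuc_invar_ordIso[OF card_of_Card_order card_of_Card_order]
      ordIso_transitive by meson
  then have "|?B| <o |?C|"
    using cardSuc_greater[OF card_of_Card_order] ordLess_ordIso_trans ordIso_symmetric by meson
  then obtain h where h: "inj_on h ?B" "h ` ?B \<subseteq> ?C"
    using ordLess_imp_ordLeq card_of_ordLeq by meson
  have "|h ` ?B| =o |?B|"
    using h(1) inj_on_imp_bij_betw card_of_ordIso ordIso_symmetric by meson
  then have "|?C| =o cardSuc |h ` ?B|"
    using CB cardSuc_invar_ordIso[OF card_of_Card_order card_of_Card_order]
      ordIso_transitive ordIso_symmetric by meson
  then have "has_aleph (Suc k) ?C"
    using h(2) has_aleph_inj_image[OF B h(1)] by auto
  then show ?thesis ..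
qed


section \<open>Locally profinite sets\<close>

definition totally_disconnected_space :: "'a topology \<Rightarrow> bool" where
  "totally_disconnected_space X \<longleftrightarrow> (\<forall>S. connectedin X S \<longrightarrow> (\<exists>a. S \<subseteq> {a}))"

definition profinite_space :: "'a topology \<Rightarrow> bool" where
  "profinite_space X \<longleftrightarrow> totally_disconnected_space X \<and> compact_space X \<and> Hausdorff_space X"

text \<open>
  The profinite set has exactly one point more than \<open>X\<close>, so up to homeomorphism it can be taken to
  live on the type \<^typ>\<open>'a option\<close>; see \<open>locally_profinite_spaceI\<close> below.
\<close>

definition locally_profinite_space :: "'a topology \<Rightarrow> bool" where
  "locally_profinite_space X \<longleftrightarrow>
    (\<exists>(P :: 'a option topology) p. profinite_space P \<and> p \<in> topspace P \<and>
        X homeomorphic_space subtopology P (topspace P - {p}))"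


lemma locally_profinite_spaceI:
  fixes P :: "'b topology" and X :: "'a topology"
  assumes P: "profinite_space P" and p: "p \<in> topspace P"
    and hom: "X homeomorphic_space subtopology P (topspace P - {p})"
  shows "locally_profinite_space X"
proof -
  obtain g where g: "homeomorphic_map (subtopology P (topspace P - {p})) X g"
    using hom homeomorphic_space homeomorphic_space_sym by blast
  then have g_inj: "inj_on g (topspace P - {p})"
    using homeomorphic_imp_injective_map[OF g] by (simp add: Int_absorb1)
  define f where "f y = (if y = p then None else Some (g y))" for y
  have f_inj: "inj_on f (topspace P)"
    using g_inj by (auto simp: f_def inj_on_def)
  define h where "h = inv_into (topspace P) f"
  define P' where "P' = pullback_topology (f ` topspace P) h P"
  have hf: "h (f y) = y" if "y \<in> topspace P" for y
    using that f_inj by (simp add: h_def)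
  have top: "topspace P' = f ` topspace P"
    by (auto simp: P'_def topspace_pullback_topology hf)
  have h_cont: "continuous_map P' P h"
    using continuous_map_pullback[OF continuous_map_id] by (simp add: P'_def)
  have "continuous_map P P' f"
    unfolding P'_def
    by (rule continuous_map_pullback') (auto simp: hf intro: continuous_map_eq[of _ _ id])
  then have maps: "homeomorphic_maps P P' f h"
    using h_cont by (auto simp: homeomorphic_maps_def hf top)
  then have f: "homeomorphic_map P P' f"
    using homeomorphic_maps_map by blast
  then have space: "P homeomorphic_space P'"
    using homeomorphic_space by blast
  have "totally_disconnected_space P'"
    unfolding totally_disconnected_space_def
  proof (intro allI impI)
    fix S assume S: "connectedin P' S"
    obtain a where a: "h ` S \<subseteq> {a}"
      using connectedin_continuous_map_image[OF h_cont S] P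
      unfolding profinite_space_def totally_disconnected_space_def by meson
    have "S \<subseteq> f ` topspace P"
      using connectedin_subset_topspace[OF S] top by simp
    then have "S \<subseteq> {f a}"
      using a hf by fastforce
    then show "\<exists>a. S \<subseteq> {a}" ..
  qed
  then have "profinite_space P'"
    using P space homeomorphic_compact_space homeomorphic_Hausdorff_space
    unfolding profinite_space_def by blast
  moreover have "f p \<in> topspace P'"
    using p top by blast
  moreover have "homeomorphic_map (subtopology P (topspace P - {p}))
      (subtopology P' (topspace P' - {f p})) f"
    by (rule homeomorphic_map_subtopologies[OF f])
      (use f_inj p in \<open>auto simp: top inj_on_def\<close>)
  ultimately show ?thesis
    unfolding locally_profinite_space_def
    using hom homeomorphic_space homeomorphic_space_trans by blast
qed


section \<open>Sheaf cohomology with constant coefficients\<close>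

text \<open>
  For a sheaf \<open>F\<close> on \<open>X\<close> let \<open>TF\<close> be the Godement sheaf \<open>V \<mapsto> (\<Prod>x\<in>V. F\<^sub>x)\<close>. Sheaf cohomology is
  computed by the global sections of Godement's canonical (cosimplicial) flasque resolution
  \<open>F \<rightarrow> TF \<rightarrow> T\<^sup>2F \<rightarrow> \<dots>\<close>; over a field, this is moreover a resolution by injective sheaves of vector
  spaces.

  A section of \<open>TF\<close> over \<open>V\<close> assigns to every \<open>x \<in> V\<close> a germ of \<open>F\<close> at \<open>x\<close>. We represent it by a
  family \<open>(s\<^sub>x)\<close> of sections of \<open>F\<close> near \<open>x\<close>; two families represent the same section iff
  for every \<open>x \<in> V\<close> the sections \<open>s\<^sub>x\<close> and \<open>t\<^sub>x\<close> agree on a neighbourhood of \<open>x\<close>. Iterating this,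
  a section of \<open>T\<^sup>m R\<close>, where \<open>R\<close> is a constant sheaf, is represented by a function
  \<open>s(x\<^sub>1, \<dots>, x\<^sub>m)\<close> with values in \<open>R\<close>. In this way sections of all the \<open>T\<^sup>m R\<close> are represented
  in the one type \<^typ>\<open>'a list \<Rightarrow> 'r\<close>, and \<open>T\<close> only acts on the relation ``\<open>s\<close> and \<open>t\<close> represent
  the same section over \<open>V\<close>''. Restriction of sections is the identity on representatives;
  a section given near a point is extended arbitrarily to a function defined everywhere.
\<close>

type_synonym ('a, 'r) section_eq = "'a set \<Rightarrow> ('a list \<Rightarrow> 'r) \<Rightarrow> ('a list \<Rightarrow> 'r) \<Rightarrow> bool"

text \<open>The constant presheaf; it has the same stalks as the constant sheaf.\<close>

definition constant_presheaf :: "('a, 'r) section_eq" where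
  "constant_presheaf V s t \<longleftrightarrow> s [] = t []"

definition godement :: "'a topology \<Rightarrow> ('a, 'r) section_eq \<Rightarrow> ('a, 'r) section_eq" where
  "godement X E V s t \<longleftrightarrow>
    (\<forall>x\<in>V. \<exists>W. openin X W \<and> x \<in> W \<and> E W (\<lambda>xs. s (x # xs)) (\<lambda>xs. t (x # xs)))"

definition godement_pow :: "'a topology \<Rightarrow> nat \<Rightarrow> ('a, 'r) section_eq" where
  "godement_pow X m = (godement X ^^ m) constant_presheaf"

text \<open>
  Degree \<open>n\<close> of the complex consists of the global sections of \<open>T\<^sup>n\<^sup>+\<^sup>1 R\<close>, i.e. of functions of
  \<open>(x\<^sub>0, \<dots>, x\<^sub>n)\<close> up to the relation below.
\<close>

abbreviation cochain_eq :: "'a topology \<Rightarrow> nat \<Rightarrow> ('a list \<Rightarrow> 'r) \<Rightarrow> ('a list \<Rightarrow> 'r) \<Rightarrow> bool" where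
  "cochain_eq X n \<equiv> godement_pow X (Suc n) (topspace X)"

text \<open>
  The differential is \<open>\<Sum>i. (-1)\<^sup>i d\<^sup>i\<close>, where the coface \<open>d\<^sup>i = T\<^sup>i \<eta> T\<^sup>n\<^sup>+\<^sup>1\<^sup>-\<^sup>i\<close> is induced by the unit
  \<open>\<eta>\<close> sending a section to the family of its germs. As \<open>\<eta>\<close> sends \<open>s\<close> to the family constantly equal
  to \<open>s\<close>, the map \<open>d\<^sup>i\<close> on representatives omits \<open>x\<^sub>i\<close>.
\<close>

definition cobd :: "('a list \<Rightarrow> 'r::comm_ring_1) \<Rightarrow> 'a list \<Rightarrow> 'r" where
  "cobd f xs = (\<Sum>i<length xs. (-1) ^ i * f (take i xs @ drop (Suc i) xs))"

definition cocycles :: "'a topology \<Rightarrow> nat \<Rightarrow> ('a list \<Rightarrow> 'r::comm_ring_1) set" where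
  "cocycles X n = {f. cochain_eq X (Suc n) (cobd f) (\<lambda>_. 0)}"

definition coboundaries :: "'a topology \<Rightarrow> nat \<Rightarrow> ('a list \<Rightarrow> 'r::comm_ring_1) set" where
  "coboundaries X n = {f. case n of
      0 \<Rightarrow> cochain_eq X 0 f (\<lambda>_. 0)
    | Suc m \<Rightarrow> \<exists>g. cochain_eq X (Suc m) f (cobd g)}"

definition cohomologous ::
    "'a topology \<Rightarrow> nat \<Rightarrow> (('a list \<Rightarrow> 'r::comm_ring_1) \<times> ('a list \<Rightarrow> 'r)) set" where
  "cohomologous X n = {(f, g). f \<in> cocycles X n \<and> g \<in> cocycles X n \<and>
      (\<lambda>xs. f xs - g xs) \<in> coboundaries X n}"

text \<open>The underlying set of \<open>H\<^sup>n(X; R)\<close>, where \<open>R\<close> is the ring of all elements of the type \<open>'r\<close>.\<close>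

definition cohomology :: "'a topology \<Rightarrow> nat \<Rightarrow> ('a list \<Rightarrow> 'r::comm_ring_1) set set" where
  "cohomology X n = cocycles X n // cohomologous X n"

definition cohomology_zero :: "'a topology \<Rightarrow> nat \<Rightarrow> ('a list \<Rightarrow> 'r::comm_ring_1) set" where
  "cohomology_zero X n = cohomologous X n `` {\<lambda>_. 0}"

text \<open>
  The product of a cochain of degree \<open>p\<close> with another cochain, as defined by Godement (the
  Alexander--Whitney product of the cosimplicial ring):
  \<open>(f \<union> g)(x\<^sub>0, \<dots>, x\<^sub>p\<^sub>+\<^sub>q) = f(x\<^sub>0, \<dots>, x\<^sub>p) g(x\<^sub>p, \<dots>, x\<^sub>p\<^sub>+\<^sub>q)\<close>.
\<close>

definition cup_cochain ::
    "nat \<Rightarrow> ('a list \<Rightarrow> 'r::comm_ring_1) \<Rightarrow> ('a list \<Rightarrow> 'r) \<Rightarrow> 'a list \<Rightarrow> 'r" where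
  "cup_cochain p f g xs = f (take (Suc p) xs) * g (drop p xs)"

definition cup ::
    "'a topology \<Rightarrow> nat \<Rightarrow> nat \<Rightarrow> ('a list \<Rightarrow> 'r::comm_ring_1) set \<Rightarrow> ('a list \<Rightarrow> 'r) set
      \<Rightarrow> ('a list \<Rightarrow> 'r) set" where
  "cup X p q \<alpha> \<beta> = (\<Union>f\<in>\<alpha>. \<Union>g\<in>\<beta>. cohomologous X (p + q) `` {cup_cochain p f g})"

text \<open>The product \<open>\<eta>\<^sub>0 \<cdots> \<eta>\<^sub>n\<close> of classes of degree 1, a class of degree \<open>n + 1\<close>.\<close>

primrec cup_deg1 ::
    "'a topology \<Rightarrow> (nat \<Rightarrow> ('a list \<Rightarrow> 'r::comm_ring_1) set) \<Rightarrow> nat \<Rightarrow> ('a list \<Rightarrow> 'r) set" where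
  "cup_deg1 X \<eta> 0 = \<eta> 0"
| "cup_deg1 X \<eta> (Suc n) = cup X (Suc n) 1 (cup_deg1 X \<eta> n) (\<eta> (Suc n))"


subsection \<open>Well-definedness\<close>

lemma godement_pow_0 [simp]: "godement_pow X 0 V s t \<longleftrightarrow> s [] = t []"
  by (simp add: godement_pow_def constant_presheaf_def)

lemma godement_pow_Suc:
  "godement_pow X (Suc m) V s t \<longleftrightarrow>
    (\<forall>x\<in>V. \<exists>W. openin X W \<and> x \<in> W \<and>
        godement_pow X m W (\<lambda>xs. s (x # xs)) (\<lambda>xs. t (x # xs)))"
  by (simp add: godement_pow_def godement_def)

lemma godement_pow_mono:
  assumes "godement_pow X m V s t" "W \<subseteq> V"
  shows "godement_pow X m W s t"
  using assms by (cases m) (auto simp: godement_pow_Suc)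

lemma godement_pow_length:
  assumes "openin X V" "\<And>xs. length xs = m \<Longrightarrow> s xs = t xs"
  shows "godement_pow X m V s t"
  using assms
proof (induction m arbitrary: s t)
  case (Suc m)
  have "godement_pow X m V (\<lambda>xs. s (x # xs)) (\<lambda>xs. t (x # xs))" for x
    by (rule Suc.IH) (use Suc.prems in auto)
  then show ?case
    using Suc.prems(1) unfolding godement_pow_Suc by blast
qed auto

lemma godement_pow_combine:
  assumes "godement_pow X m V s t" "godement_pow X m V s' t'"
  shows "godement_pow X m V (\<lambda>xs. h (s xs) (s' xs)) (\<lambda>xs. h (t xs) (t' xs))"
  using assms
proof (induction m arbitrary: V s t s' t')
  case (Suc m)
  show ?case unfolding godement_pow_Suc
  proof
    fix x assume "x \<in> V"
    with Suc.prems obtain W W' where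
      W: "openin X W" "x \<in> W" "godement_pow X m W (\<lambda>xs. s (x # xs)) (\<lambda>xs. t (x # xs))" and
      W': "openin X W'" "x \<in> W'" "godement_pow X m W' (\<lambda>xs. s' (x # xs)) (\<lambda>xs. t' (x # xs))"
      unfolding godement_pow_Suc by metis
    have "godement_pow X m (W \<inter> W') (\<lambda>xs. h (s (x # xs)) (s' (x # xs)))
        (\<lambda>xs. h (t (x # xs)) (t' (x # xs)))"
      by (rule Suc.IH) (use W W' godement_pow_mono in blast)+
    then show "\<exists>W. openin X W \<and> x \<in> W \<and> godement_pow X m W
        (\<lambda>xs. h (s (x # xs)) (s' (x # xs))) (\<lambda>xs. h (t (x # xs)) (t' (x # xs)))"
      using W W' by (intro exI[of _ "W \<inter> W'"]) auto
  qed
qed auto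

lemma godement_pow_refl: "openin X V \<Longrightarrow> godement_pow X m V s s"
  by (rule godement_pow_length) auto

lemma godement_pow_sym: "godement_pow X m V s t \<Longrightarrow> godement_pow X m V t s"
proof (induction m arbitrary: V s t)
  case (Suc m)
  then show ?case unfolding godement_pow_Suc by meson
qed auto

lemma godement_pow_trans:
  assumes "godement_pow X m V s t" "godement_pow X m V t u"
  shows "godement_pow X m V s u"
  using assms
proof (induction m arbitrary: V s t u)
  case (Suc m)
  show ?case unfolding godement_pow_Suc
  proof
    fix x assume "x \<in> V"
    with Suc.prems obtain W W' where
      W: "openin X W" "x \<in> W" "godement_pow X m W (\<lambda>xs. s (x # xs)) (\<lambda>xs. t (x # xs))" and
      W': "openin X W'" "x \<in> W'" "godement_pow X m W' (\<lambda>xs. t (x # xs)) (\<lambda>xs. u (x # xs))"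
      unfolding godement_pow_Suc by metis
    have "godement_pow X m (W \<inter> W') (\<lambda>xs. s (x # xs)) (\<lambda>xs. u (x # xs))"
      by (rule Suc.IH[of _ _ "\<lambda>xs. t (x # xs)"]) (use W W' godement_pow_mono in blast)+
    then show "\<exists>W. openin X W \<and> x \<in> W \<and> godement_pow X m W
        (\<lambda>xs. s (x # xs)) (\<lambda>xs. u (x # xs))"
      using W W' by (intro exI[of _ "W \<inter> W'"]) auto
  qed
qed auto

lemma godement_pow_diff_iff:
  fixes s t :: "'a list \<Rightarrow> 'r::comm_ring_1"
  assumes "openin X V"
  shows "godement_pow X m V (\<lambda>xs. s xs - t xs) (\<lambda>_. 0) \<longleftrightarrow> godement_pow X m V s t"
proof
  assume "godement_pow X m V (\<lambda>xs. s xs - t xs) (\<lambda>_. 0)"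
  from godement_pow_combine[OF this godement_pow_refl[OF assms, of m t], of "(+)"]
  show "godement_pow X m V s t" by simp
next
  assume "godement_pow X m V s t"
  from godement_pow_combine[OF this godement_pow_refl[OF assms, of m t], of "(-)"]
  show "godement_pow X m V (\<lambda>xs. s xs - t xs) (\<lambda>_. 0)" by simp
qed

lemma cobd_Nil [simp]: "cobd f [] = 0"
  by (simp add: cobd_def)

lemma cobd_Cons [simp]: "cobd f (x # xs) = f xs - cobd (\<lambda>ys. f (x # ys)) xs"
  by (simp add: cobd_def sum.lessThan_Suc_shift sum_negf[symmetric] del: sum.lessThan_Suc)

lemma cobd_0 [simp]: "cobd (\<lambda>_. 0) = (\<lambda>_. 0)"
  by (simp add: cobd_def fun_eq_iff)

lemma cobd_diff: "cobd (\<lambda>xs. f xs - g xs) = (\<lambda>xs. cobd f xs - cobd g xs)"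
  by (simp add: cobd_def fun_eq_iff right_diff_distrib sum_subtractf)

lemma cobd_add: "cobd (\<lambda>xs. f xs + g xs) = (\<lambda>xs. cobd f xs + cobd g xs)"
  by (simp add: cobd_def fun_eq_iff distrib_left sum.distrib)

lemma cobd_scale: "cobd (\<lambda>xs. c * f xs) = (\<lambda>xs. c * cobd f xs)"
  by (simp add: cobd_def fun_eq_iff sum_distrib_left mult.left_commute)

lemma cobd_cobd: "cobd (cobd f) xs = 0"
proof (induction xs arbitrary: f)
  case (Cons x xs)
  then show ?case by (simp add: cobd_diff)
qed simp

lemma cobd_cong:
  assumes "openin X V" "godement_pow X m V f g"
  shows "godement_pow X (Suc m) V (cobd f) (cobd g)"
  using assms
proof (induction m arbitrary: V f g)
  case 0
  then show ?case by (auto simp: godement_pow_Suc)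
next
  case (Suc m)
  show ?case unfolding godement_pow_Suc[of _ "Suc m"]
  proof
    fix x assume "x \<in> V"
    with Suc.prems obtain W where
      W: "openin X W" "x \<in> W" "godement_pow X m W (\<lambda>xs. f (x # xs)) (\<lambda>xs. g (x # xs))"
      unfolding godement_pow_Suc by metis
    have "godement_pow X (Suc m) (V \<inter> W) (cobd (\<lambda>xs. f (x # xs))) (cobd (\<lambda>xs. g (x # xs)))"
      by (rule godement_pow_mono[OF Suc.IH[OF W(1,3)]]) auto
    moreover have "godement_pow X (Suc m) (V \<inter> W) f g"
      using Suc.prems(2) by (rule godement_pow_mono) auto
    ultimately have "godement_pow X (Suc m) (V \<inter> W)
        (\<lambda>xs. cobd f (x # xs)) (\<lambda>xs. cobd g (x # xs))"
      using godement_pow_combine[of X "Suc m" "V \<inter> W" f g _ _ "(-)"] by simp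
    then show "\<exists>W. openin X W \<and> x \<in> W \<and>
        godement_pow X (Suc m) W (\<lambda>xs. cobd f (x # xs)) (\<lambda>xs. cobd g (x # xs))"
      using W \<open>x \<in> V\<close> Suc.prems(1) by (intro exI[of _ "V \<inter> W"]) auto
  qed
qed

text \<open>The complex of sheaves is exact in positive degrees: every cocycle is locally a coboundary.\<close>

lemma cocycle_locally_coboundary:
  assumes "f \<in> cocycles X (Suc n)" "x \<in> topspace X"
  shows "\<exists>W g. openin X W \<and> x \<in> W \<and> godement_pow X (Suc (Suc n)) W f (cobd g)"
proof -
  obtain W where W: "openin X W" "x \<in> W"
      "godement_pow X (Suc (Suc n)) W (\<lambda>xs. cobd f (x # xs)) (\<lambda>_. 0)"
    using assms unfolding cocycles_def godement_pow_Suc[of _ "Suc (Suc n)"] by auto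
  then have "godement_pow X (Suc (Suc n)) W f (cobd (\<lambda>xs. f (x # xs)))"
    by (simp add: godement_pow_diff_iff)
  with W show ?thesis by blast
qed

text \<open>In degree 0, the cocycles are the locally constant functions.\<close>

lemma cocycles_0_iff:
  "f \<in> cocycles X 0 \<longleftrightarrow>
    (\<forall>x\<in>topspace X. \<exists>W. openin X W \<and> x \<in> W \<and> (\<forall>y\<in>W. f [y] = f [x]))"
proof -
  have "(\<forall>y\<in>W. \<exists>W'. openin X W' \<and> y \<in> W' \<and> f [y] - f [x] = 0) \<longleftrightarrow>
      (\<forall>y\<in>W. f [y] = f [x])" if "openin X W" for W x
    using that by auto
  then show ?thesis
    by (simp add: cocycles_def godement_pow_Suc cong: conj_cong)
qed

lemma coboundaries_subset_cocycles: "coboundaries X n \<subseteq> cocycles X n"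
proof
  fix f :: "'a list \<Rightarrow> 'b" assume f: "f \<in> coboundaries X n"
  have "\<exists>g. cochain_eq X n f g \<and> cobd g = (\<lambda>_. 0)"
  proof (cases n)
    case 0
    then show ?thesis
      using f by (intro exI[of _ "\<lambda>_. 0"]) (simp add: coboundaries_def)
  next
    case (Suc m)
    then obtain h where "cochain_eq X n f (cobd h)"
      using f by (auto simp: coboundaries_def)
    moreover have "cobd (cobd h) = (\<lambda>_. 0)"
      by (rule ext) (rule cobd_cobd)
    ultimately show ?thesis by blast
  qed
  then obtain g where g: "cochain_eq X n f g" "cobd g = (\<lambda>_. 0)"
    by blast
  then show "f \<in> cocycles X n"
    using cobd_cong[OF openin_topspace g(1)] by (simp add: cocycles_def)
qed

lemma coboundaries_0: "(\<lambda>_. 0 :: 'r::comm_ring_1) \<in> coboundaries X n"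
proof (cases n)
  case (Suc m)
  have "cochain_eq X (Suc m) (\<lambda>_. 0 :: 'r) (cobd (\<lambda>_. 0))"
    by (simp add: godement_pow_refl)
  then have "\<exists>g. cochain_eq X (Suc m) (\<lambda>_. 0 :: 'r) (cobd g)"
    by blast
  with Suc show ?thesis
    by (simp add: coboundaries_def)
qed (simp add: coboundaries_def godement_pow_refl)

lemma coboundaries_add_scale:
  assumes "f \<in> coboundaries X n" "g \<in> coboundaries X n"
  shows "(\<lambda>xs. f xs + c * g xs) \<in> coboundaries X n"
proof (cases n)
  case 0
  then show ?thesis
    using assms godement_pow_combine[of X "Suc 0" "topspace X" f "\<lambda>_. 0" g "\<lambda>_. 0" "\<lambda>a b. a + c * b"]
    by (simp add: coboundaries_def)
next
  case (Suc m)
  with assms obtain f' g' where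
    "cochain_eq X n f (cobd f')" "cochain_eq X n g (cobd g')"
    by (auto simp: coboundaries_def)
  from godement_pow_combine[OF this, of "\<lambda>a b. a + c * b"]
  have "cochain_eq X n (\<lambda>xs. f xs + c * g xs) (cobd (\<lambda>xs. f' xs + c * g' xs))"
    by (simp add: cobd_add cobd_scale)
  then show ?thesis
    using Suc by (auto simp: coboundaries_def)
qed

lemma equiv_cohomologous:
  "equiv (cocycles X n) (cohomologous X n :: (('a list \<Rightarrow> 'r::comm_ring_1) \<times> _) set)"
proof (rule equivI)
  let ?R = "cohomologous X n :: (('a list \<Rightarrow> 'r) \<times> _) set"
  show "?R \<subseteq> cocycles X n \<times> cocycles X n"
    by (auto simp: cohomologous_def)
  show "refl_on (cocycles X n) ?R"
    by (auto simp: refl_on_def cohomologous_def coboundaries_0)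
  show "sym ?R"
  proof (rule symI)
    fix f g :: "'a list \<Rightarrow> 'r"
    assume "(f, g) \<in> cohomologous X n"
    then show "(g, f) \<in> cohomologous X n"
      using coboundaries_add_scale[OF coboundaries_0, of "\<lambda>xs. f xs - g xs" X n "-1"]
      by (auto simp: cohomologous_def)
  qed
  show "trans ?R"
  proof (rule transI)
    fix f g h :: "'a list \<Rightarrow> 'r"
    assume "(f, g) \<in> cohomologous X n" "(g, h) \<in> cohomologous X n"
    then show "(f, h) \<in> cohomologous X n"
      using coboundaries_add_scale[of "\<lambda>xs. f xs - g xs" X n "\<lambda>xs. g xs - h xs" 1]
      by (auto simp: cohomologous_def)
  qed
qed

lemma cohomology_zero_eq:
  "cohomology_zero X n = (coboundaries X n :: ('a list \<Rightarrow> 'r::comm_ring_1) set)"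
proof -
  have "(\<lambda>_. 0 :: 'r) \<in> cocycles X n"
    using coboundaries_0 coboundaries_subset_cocycles by blast
  moreover have "(\<lambda>xs. - f xs) \<in> coboundaries X n \<longleftrightarrow> f \<in> coboundaries X n"
    for f :: "'a list \<Rightarrow> 'r"
    using coboundaries_add_scale[OF coboundaries_0, of f X n "-1"]
      coboundaries_add_scale[OF coboundaries_0, of "\<lambda>xs. - f xs" X n "-1"] by auto
  ultimately show ?thesis
    using coboundaries_subset_cocycles[of X n]
    by (auto simp: cohomology_zero_def cohomologous_def)
qed

lemma cup_cochain_cong:
  assumes "openin X V" "godement_pow X (Suc p) V f f'" "godement_pow X (Suc q) V g g'"
  shows "godement_pow X (Suc (p + q)) V (cup_cochain p f g) (cup_cochain p f' g')"
  using assms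
proof (induction p arbitrary: V f f')
  case 0
  show ?case unfolding godement_pow_Suc
  proof
    fix x assume "x \<in> V"
    with "0.prems" obtain W where
      W: "openin X W" "x \<in> W" "godement_pow X q W (\<lambda>xs. g (x # xs)) (\<lambda>xs. g' (x # xs))"
      unfolding godement_pow_Suc by metis
    have "f [x] = f' [x]"
      using "0.prems" \<open>x \<in> V\<close> by (auto simp: godement_pow_Suc)
    then have "godement_pow X (0 + q) W (\<lambda>xs. cup_cochain 0 f g (x # xs))
        (\<lambda>xs. cup_cochain 0 f' g' (x # xs))"
      using godement_pow_combine[OF W(3) W(3), of "\<lambda>a _. f [x] * a"]
      by (simp add: cup_cochain_def)
    with W show "\<exists>W. openin X W \<and> x \<in> W \<and> godement_pow X (0 + q) W
        (\<lambda>xs. cup_cochain 0 f g (x # xs)) (\<lambda>xs. cup_cochain 0 f' g' (x # xs))"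
      by blast
  qed
next
  case (Suc p)
  show ?case unfolding godement_pow_Suc[of _ "Suc p + q"]
  proof
    fix x assume "x \<in> V"
    with Suc.prems obtain W where
      W: "openin X W" "x \<in> W"
        "godement_pow X (Suc p) W (\<lambda>xs. f (x # xs)) (\<lambda>xs. f' (x # xs))"
      unfolding godement_pow_Suc[of _ "Suc p"] by metis
    have "godement_pow X (Suc (p + q)) (V \<inter> W)
        (cup_cochain p (\<lambda>xs. f (x # xs)) g) (cup_cochain p (\<lambda>xs. f' (x # xs)) g')"
    proof (rule Suc.IH)
      show "openin X (V \<inter> W)"
        using W(1) Suc.prems(1) by blast
      show "godement_pow X (Suc p) (V \<inter> W) (\<lambda>xs. f (x # xs)) (\<lambda>xs. f' (x # xs))"
        using W(3) by (rule godement_pow_mono) blast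
      show "godement_pow X (Suc q) (V \<inter> W) g g'"
        using Suc.prems(3) by (rule godement_pow_mono) blast
    qed
    then have "godement_pow X (Suc p + q) (V \<inter> W) (\<lambda>xs. cup_cochain (Suc p) f g (x # xs))
        (\<lambda>xs. cup_cochain (Suc p) f' g' (x # xs))"
      by (simp add: cup_cochain_def[abs_def])
    then show "\<exists>W. openin X W \<and> x \<in> W \<and> godement_pow X (Suc p + q) W
        (\<lambda>xs. cup_cochain (Suc p) f g (x # xs)) (\<lambda>xs. cup_cochain (Suc p) f' g' (x # xs))"
      using W \<open>x \<in> V\<close> Suc.prems(1) by (intro exI[of _ "V \<inter> W"]) auto
  qed
qed

lemma cobd_cup_cochain:
  assumes "length xs \<ge> p + 2"
  shows "cobd (cup_cochain p f g) xs =
    cup_cochain (Suc p) (cobd f) g xs + (-1) ^ p * cup_cochain p f (cobd g) xs"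
  using assms
proof (induction p arbitrary: f xs)
  case 0
  then obtain x y zs where xs: "xs = x # y # zs"
    by (cases xs; cases "tl xs") auto
  show ?case
    by (simp add: xs cup_cochain_def cobd_scale) (simp add: algebra_simps)
next
  case (Suc p)
  then obtain x ys where xs: "xs = x # ys" and ys: "length ys \<ge> p + 2"
    by (cases xs) auto
  have "(\<lambda>ys. cup_cochain (Suc p) f g (x # ys)) = cup_cochain p (\<lambda>ys. f (x # ys)) g"
    by (simp add: cup_cochain_def fun_eq_iff)
  then have "cobd (cup_cochain (Suc p) f g) xs =
      cup_cochain (Suc p) f g ys - cobd (cup_cochain p (\<lambda>ys. f (x # ys)) g) ys"
    by (simp add: xs)
  also have "\<dots> = cup_cochain (Suc p) f g ys
      - (cup_cochain (Suc p) (cobd (\<lambda>ys. f (x # ys))) g ys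
         + (-1) ^ p * cup_cochain p (\<lambda>ys. f (x # ys)) (cobd g) ys)"
    by (simp only: Suc.IH[OF ys])
  also have "\<dots> = cup_cochain (Suc (Suc p)) (cobd f) g xs
      + (-1) ^ Suc p * cup_cochain (Suc p) f (cobd g) xs"
    by (simp add: xs cup_cochain_def algebra_simps)
  finally show ?case .
qed

lemma cobd_cup_cochain_eq:
  "cochain_eq X (Suc (p + q)) (cobd (cup_cochain p f g))
    (\<lambda>xs. cup_cochain (Suc p) (cobd f) g xs + (-1) ^ p * cup_cochain p f (cobd g) xs)"
  by (rule godement_pow_length) (auto intro!: cobd_cup_cochain)

lemma cup_cochain_cocycles:
  assumes "f \<in> cocycles X p" "g \<in> cocycles X q"
  shows "cup_cochain p f g \<in> cocycles X (p + q)"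
proof -
  have 1: "cochain_eq X (Suc (p + q)) (cup_cochain (Suc p) (cobd f) g) (\<lambda>_. 0)"
    using cup_cochain_cong[of X "topspace X" "Suc p" "cobd f" "\<lambda>_. 0" q g g] assms
    by (simp add: cocycles_def godement_pow_refl cup_cochain_def[abs_def])
  have 2: "cochain_eq X (Suc (p + q)) (cup_cochain p f (cobd g)) (\<lambda>_. 0)"
    using cup_cochain_cong[of X "topspace X" p f f "Suc q" "cobd g" "\<lambda>_. 0"] assms
    by (simp add: cocycles_def godement_pow_refl cup_cochain_def[abs_def])
  have "cochain_eq X (Suc (p + q)) (cobd (cup_cochain p f g)) (\<lambda>_. 0)"
    using godement_pow_trans[OF cobd_cup_cochain_eq[where p = p]
        godement_pow_combine[OF 1 2, of "\<lambda>a b. a + (-1) ^ p * b"]] by simp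
  then show ?thesis
    by (simp add: cocycles_def)
qed

lemma cup_cochain_coboundary_left:
  assumes "f \<in> coboundaries X p" "g \<in> cocycles X q"
  shows "cup_cochain p f g \<in> coboundaries X (p + q)"
proof (cases p)
  case 0
  then have eq: "cochain_eq X q (cup_cochain p f g) (\<lambda>_. 0)"
    using cup_cochain_cong[of X "topspace X" p f "\<lambda>_. 0" q g g] assms
    by (simp add: coboundaries_def godement_pow_refl cup_cochain_def[abs_def])
  show ?thesis
  proof (cases q)
    case (Suc m)
    then show ?thesis
      using eq 0 by (auto simp: coboundaries_def intro: exI[where x = "\<lambda>_. 0"])
  qed (use eq 0 in \<open>simp add: coboundaries_def\<close>)
next
  case (Suc m)
  with assms obtain h where h: "cochain_eq X (Suc m) f (cobd h)"
    by (auto simp: coboundaries_def)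
  have "cochain_eq X (Suc (m + q)) (cup_cochain m h (cobd g)) (\<lambda>_. 0)"
    using cup_cochain_cong[of X "topspace X" m h h "Suc q" "cobd g" "\<lambda>_. 0"] assms
    by (simp add: cocycles_def godement_pow_refl cup_cochain_def[abs_def])
  from godement_pow_combine[OF
      godement_pow_refl[OF openin_topspace, of X _ "cup_cochain (Suc m) (cobd h) g"] this,
      of "\<lambda>a b. a + (-1) ^ m * b"]
  have "cochain_eq X (Suc (m + q)) (cobd (cup_cochain m h g)) (cup_cochain (Suc m) (cobd h) g)"
    using godement_pow_trans[OF cobd_cup_cochain_eq] by simp
  moreover have "cochain_eq X (Suc (m + q)) (cup_cochain (Suc m) f g)
      (cup_cochain (Suc m) (cobd h) g)"
    using cup_cochain_cong[OF openin_topspace h godement_pow_refl[OF openin_topspace], of q g]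
    by simp
  ultimately have "cochain_eq X (Suc (m + q)) (cup_cochain (Suc m) f g) (cobd (cup_cochain m h g))"
    using godement_pow_sym godement_pow_trans by blast
  then show ?thesis
    using Suc by (auto simp: coboundaries_def)
qed

lemma cup_cochain_coboundary_right:
  assumes "f \<in> cocycles X p" "g \<in> coboundaries X q"
  shows "cup_cochain p f g \<in> coboundaries X (p + q)"
proof (cases q)
  case 0
  then have eq: "cochain_eq X p (cup_cochain p f g) (\<lambda>_. 0)"
    using cup_cochain_cong[of X "topspace X" p f f q g "\<lambda>_. 0"] assms
    by (simp add: coboundaries_def godement_pow_refl cup_cochain_def[abs_def])
  show ?thesis
  proof (cases p)
    case (Suc m)
    then show ?thesis
      using eq 0 by (auto simp: coboundaries_def intro: exI[where x = "\<lambda>_. 0"])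
  qed (use eq 0 in \<open>simp add: coboundaries_def\<close>)
next
  case (Suc m)
  with assms obtain h where h: "cochain_eq X (Suc m) g (cobd h)"
    by (auto simp: coboundaries_def)
  let ?h = "\<lambda>xs. (-1) ^ p * cup_cochain p f h xs"
  have "cochain_eq X (Suc (p + m)) (cup_cochain (Suc p) (cobd f) h) (\<lambda>_. 0)"
    using cup_cochain_cong[of X "topspace X" "Suc p" "cobd f" "\<lambda>_. 0" m h h] assms
    by (simp add: cocycles_def godement_pow_refl cup_cochain_def[abs_def])
  from godement_pow_combine[OF this
      godement_pow_refl[OF openin_topspace, of X _ "cup_cochain p f (cobd h)"],
      of "\<lambda>a b. a + (-1) ^ p * b"]
  have "cochain_eq X (Suc (p + m)) (cobd (cup_cochain p f h))
      (\<lambda>xs. (-1) ^ p * cup_cochain p f (cobd h) xs)"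
    using godement_pow_trans[OF cobd_cup_cochain_eq] by simp
  from godement_pow_combine[OF this this, of "\<lambda>a _. (-1) ^ p * a"]
  have "cochain_eq X (Suc (p + m)) (cobd ?h) (cup_cochain p f (cobd h))"
    by (simp add: cobd_scale mult.assoc[symmetric] power_add[symmetric]
        mult_2[symmetric])
  moreover have "cochain_eq X (Suc (p + m)) (cup_cochain p f g) (cup_cochain p f (cobd h))"
    using cup_cochain_cong[OF openin_topspace godement_pow_refl[OF openin_topspace] h, of p f]
    by simp
  ultimately have "cochain_eq X (Suc (p + m)) (cup_cochain p f g) (cobd ?h)"
    using godement_pow_sym godement_pow_trans by blast
  then show ?thesis
    using Suc by (auto simp: coboundaries_def)
qed

lemma cup_cochain_cohomologous:
  assumes "(f, f') \<in> cohomologous X p" "(g, g') \<in> cohomologous X q"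
  shows "(cup_cochain p f g, cup_cochain p f' g') \<in> cohomologous X (p + q)"
proof -
  have "cup_cochain p (\<lambda>xs. f xs - f' xs) g \<in> coboundaries X (p + q)"
    and "cup_cochain p f' (\<lambda>xs. g xs - g' xs) \<in> coboundaries X (p + q)"
    using assms by (auto simp: cohomologous_def
        intro: cup_cochain_coboundary_left cup_cochain_coboundary_right)
  from coboundaries_add_scale[OF this, of 1]
  have "(\<lambda>xs. cup_cochain p f g xs - cup_cochain p f' g' xs) \<in> coboundaries X (p + q)"
    by (simp add: cup_cochain_def algebra_simps)
  then show ?thesis
    using assms by (auto simp: cohomologous_def cup_cochain_cocycles)
qed

lemma cup_class:
  assumes "f \<in> cocycles X p" "g \<in> cocycles X q"
  shows "cup X p q (cohomologous X p `` {f}) (cohomologous X q `` {g}) =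
    cohomologous X (p + q) `` {cup_cochain p f g}"
proof -
  have "cohomologous X (p + q) `` {cup_cochain p f' g'} =
      cohomologous X (p + q) `` {cup_cochain p f g}"
    if "f' \<in> cohomologous X p `` {f}" "g' \<in> cohomologous X q `` {g}" for f' g'
    using that equiv_class_eq[OF equiv_cohomologous cup_cochain_cohomologous] by blast
  moreover have "f \<in> cohomologous X p `` {f}" "g \<in> cohomologous X q `` {g}"
    using assms equiv_class_self[OF equiv_cohomologous] by blast+
  ultimately show ?thesis
    unfolding cup_def by blast
qed

lemma cup_in_cohomology:
  assumes "\<alpha> \<in> cohomology X p" "\<beta> \<in> cohomology X q"
  shows "cup X p q \<alpha> \<beta> \<in> cohomology X (p + q)"
proof -
  obtain f g where "f \<in> cocycles X p" "\<alpha> = cohomologous X p `` {f}"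
      "g \<in> cocycles X q" "\<beta> = cohomologous X q `` {g}"
    using assms unfolding cohomology_def by (auto elim!: quotientE)
  then show ?thesis
    using cup_class cup_cochain_cocycles unfolding cohomology_def
    by (metis quotientI)
qed

lemma cohomology_zero_in_cohomology: "cohomology_zero X n \<in> cohomology X n"
  using coboundaries_0[of X n] coboundaries_subset_cocycles[of X n]
  unfolding cohomology_zero_def cohomology_def by (blast intro: quotientI)

lemma cup_deg1_in_cohomology:
  assumes "\<And>i. i \<le> n \<Longrightarrow> \<eta> i \<in> cohomology X 1"
  shows "cup_deg1 X \<eta> n \<in> cohomology X (n + 1)"
  using assms
proof (induction n)
  case (Suc n)
  have "cup X (n + 1) 1 (cup_deg1 X \<eta> n) (\<eta> (Suc n)) \<in> cohomology X (n + 1 + 1)"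
    by (rule cup_in_cohomology) (use Suc in auto)
  then show ?case by simp
qed simp

end

theory Submission
  imports Defs
begin

text \<open>
  For discrete sets \<open>A\<close>, \<open>B\<close> let the plank be \<open>(A \<union> {\<infinity>}) \<times> (B \<union> {\<infinity>})\<close> without the point \<open>(\<infinity>, \<infinity>)\<close>.
  A function \<open>f\<close> on \<open>A \<times> B\<close> is a Cech 1-cocycle for the covering of the plank by \<open>a \<noteq> \<infinity>\<close> and
  \<open>b \<noteq> \<infinity>\<close>, and thus defines a class \<open>\<eta>\<close> in \<open>H\<^sup>1\<close>. The space \<open>U\<close> is a product of \<open>n + 1\<close> planks with
  \<open>|A\<^sub>i| = \<aleph>\<^sub>2\<^sub>i\<close> and \<open>|B\<^sub>i| = \<aleph>\<^sub>2\<^sub>i\<^sub>+\<^sub>1\<close>.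

  Let \<open>c\<close> be a nonzero class on a space \<open>W\<close> with \<open>|W| < |A|\<close> and \<open>|B|\<close> the successor of \<open>|A|\<close>, and suppose
  that \<open>c \<union> \<eta>\<close> is the coboundary of \<open>h\<close> on the product of \<open>W\<close> with the plank. Then \<open>h\<close> is a cocycle where
  \<open>a \<noteq> \<infinity>\<close>, and, up to sign, \<open>h - c f\<close> is one where \<open>b \<noteq> \<infinity>\<close>. A cocycle on a product of \<open>W\<close> with
  \<open>B \<union> {\<infinity>}\<close> has cohomologous restrictions to \<open>W \<times> {b}\<close> and \<open>W \<times> {\<infinity>}\<close> for all but about \<open>|W|\<close> many
  \<open>b\<close>: each step of the prism homotopy moves a point from \<open>\<infinity>\<close> to \<open>b\<close> within a neighbourhood of \<open>\<infinity>\<close>, which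
  excludes finitely many \<open>b\<close> for each of the tuples in \<open>W\<close>. Hence for suitable \<open>a\<close>, \<open>a'\<close>, \<open>b\<close>, \<open>b'\<close> the mixed
  second difference of the classes of \<open>h\<close> vanishes, and so does that of \<open>f c\<close>. If \<open>f\<close> is the incidence
  function of \<open>|B|\<close> subsets of \<open>A\<close> any two of which agree and differ on \<open>|A|\<close> many elements, the
  coefficient can be made a unit, whence \<open>c = 0\<close>.
\<close>


section \<open>Cochains and continuous maps\<close>

text \<open>As \<open>V\<close> is open, it can serve as the neighbourhood at every stage, so only
  tuples with all entries in \<open>V\<close> matter.\<close>

lemma godement_pow_on:
  assumes "openin X V" "\<And>xs. length xs = m \<Longrightarrow> set xs \<subseteq> V \<Longrightarrow> s xs = t xs"
  shows "godement_pow X m V s t"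
  using assms
proof (induction m arbitrary: s t)
  case (Suc m)
  have "godement_pow X m V (\<lambda>xs. s (x # xs)) (\<lambda>xs. t (x # xs))" if "x \<in> V" for x
    by (rule Suc.IH) (use Suc.prems that in auto)
  then show ?case
    using Suc.prems(1) unfolding godement_pow_Suc by blast
qed auto

lemma godement_pow_pullback:
  assumes "continuous_map X Y p" "godement_pow Y m V s t"
  shows "godement_pow X m {x \<in> topspace X. p x \<in> V} (s \<circ> map p) (t \<circ> map p)"
  using assms(2)
proof (induction m arbitrary: V s t)
  case (Suc m)
  show ?case
    unfolding godement_pow_Suc
  proof
    fix x assume x: "x \<in> {x \<in> topspace X. p x \<in> V}"
    with Suc.prems obtain W where W: "openin Y W" "p x \<in> W"
        "godement_pow Y m W (\<lambda>xs. s (p x # xs)) (\<lambda>xs. t (p x # xs))"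
      unfolding godement_pow_Suc by blast
    have "openin X {x \<in> topspace X. p x \<in> W}"
      using assms(1) W(1) by (rule openin_continuous_map_preimage)
    with Suc.IH[OF W(3)] W(2) x
    show "\<exists>W. openin X W \<and> x \<in> W \<and> godement_pow X m W
        (\<lambda>xs. (s \<circ> map p) (x # xs)) (\<lambda>xs. (t \<circ> map p) (x # xs))"
      by (intro exI[of _ "{x \<in> topspace X. p x \<in> W}"]) (auto simp: o_def)
  qed
qed auto

lemma cochain_eq_pullback:
  assumes "continuous_map X Y p" "cochain_eq Y m s t"
  shows "cochain_eq X m (s \<circ> map p) (t \<circ> map p)"
proof -
  have "{x \<in> topspace X. p x \<in> topspace Y} = topspace X"
    using continuous_map_image_subset_topspace[OF assms(1)] by blast
  then show ?thesis
    using godement_pow_pullback[OF assms] by simp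
qed

lemma cobd_map: "cobd (f \<circ> map p) = cobd f \<circ> map p"
proof
  show "cobd (f \<circ> map p) xs = (cobd f \<circ> map p) xs" for xs
  proof (induction xs arbitrary: f)
    case (Cons x xs)
    then show ?case
      using Cons[of "\<lambda>ys. f (p x # ys)"] by (simp add: o_def)
  qed simp
qed

lemma cup_cochain_map:
  "cup_cochain p f g \<circ> map q = cup_cochain p (f \<circ> map q) (g \<circ> map q)"
  by (simp add: cup_cochain_def fun_eq_iff take_map drop_map)

lemma cocycles_pullback:
  assumes "continuous_map X Y p" "f \<in> cocycles Y n"
  shows "f \<circ> map p \<in> cocycles X n"
  using cochain_eq_pullback[OF assms(1), of "Suc n" "cobd f" "\<lambda>_. 0"] assms(2)
  unfolding cocycles_def mem_Collect_eq cobd_map by (simp add: o_def)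

lemma coboundaries_pullback:
  assumes "continuous_map X Y p" "f \<in> coboundaries Y n"
  shows "f \<circ> map p \<in> coboundaries X n"
proof (cases n)
  case 0
  then show ?thesis
    using cochain_eq_pullback[OF assms(1), of 0 f "\<lambda>_. 0"] assms(2)
    by (simp add: coboundaries_def o_def)
next
  case (Suc m)
  with assms(2) obtain g where "cochain_eq Y (Suc m) f (cobd g)"
    by (auto simp: coboundaries_def)
  from cochain_eq_pullback[OF assms(1) this] show ?thesis
    using Suc by (auto simp: coboundaries_def cobd_map[symmetric])
qed

lemma coboundaries_cong:
  assumes "cochain_eq X n f g" "g \<in> coboundaries X n"
  shows "f \<in> coboundaries X n"
  using assms by (cases n) (auto simp: coboundaries_def intro: godement_pow_trans)

lemma coboundaries_cong':
  assumes "f \<in> coboundaries X n"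
    "\<And>xs. length xs = Suc n \<Longrightarrow> set xs \<subseteq> topspace X \<Longrightarrow> g xs = f xs"
  shows "g \<in> coboundaries X n"
  by (rule coboundaries_cong[OF godement_pow_on]) (use assms in auto)

lemma coboundaries_scale:
  "f \<in> coboundaries X n \<Longrightarrow> (\<lambda>xs. c * f xs) \<in> coboundaries X n"
  using coboundaries_add_scale[OF coboundaries_0, of f X n c] by simp

lemma coboundaries_diff:
  "f \<in> coboundaries X n \<Longrightarrow> g \<in> coboundaries X n \<Longrightarrow> (\<lambda>xs. f xs - g xs) \<in> coboundaries X n"
  using coboundaries_add_scale[of f X n g "-1"] by simp


section \<open>The prism operator\<close>

text \<open>For \<open>ws = [w_0, ..., w_m]\<close> this is the sum over \<open>i\<close> of
  \<open>(-1)^i s [j w_0, ..., j w_i, k w_i, ..., k w_m]\<close>.\<close>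

fun prism :: "('b \<Rightarrow> 'a) \<Rightarrow> ('b \<Rightarrow> 'a) \<Rightarrow> ('a list \<Rightarrow> 'r::comm_ring_1) \<Rightarrow> 'b list \<Rightarrow> 'r" where
  "prism j k s [] = 0"
| "prism j k s (w # ws) = s (j w # k w # map k ws) - prism j k (\<lambda>ys. s (j w # ys)) ws"

lemma prism_diff: "prism j k (\<lambda>xs. s xs - t xs) ws = prism j k s ws - prism j k t ws"
  by (induction ws arbitrary: s t) simp_all

text \<open>A formal identity on tuples. The topological question is whether the prism of a cochain
  with zero germs again has zero germs, as \<open>j w\<close> and \<open>k w\<close> need not be
  close.\<close>

lemma prism_homotopy:
  "cobd (prism j k s) ws + prism j k (cobd s) ws = s (map k ws) - s (map j ws)"
proof (induction ws arbitrary: s)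
  case (Cons w ws)
  have "cobd (\<lambda>ys. s (j w # k w # map k ys)) ws = cobd (\<lambda>ys. s (j w # k w # ys)) (map k ws)"
    using cobd_map[of "\<lambda>ys. s (j w # k w # ys)" k] by (simp add: o_def fun_eq_iff)
  then show ?case
    using Cons.IH[of "\<lambda>ys. s (j w # ys)"]
    by (simp add: prism_diff cobd_diff algebra_simps)
qed simp

text \<open>Finitely many exceptions for each point of \<open>W\<close> accumulate to such a set.
  The two cases allow finite \<open>W\<close>, as for the one-point space that starts the induction,
  as well as infinite \<open>W\<close>.\<close>

definition small_for :: "'w set \<Rightarrow> 'b set \<Rightarrow> bool" where
  "small_for W E \<longleftrightarrow> finite E \<or> infinite W \<and> |E| \<le>o |W|"

lemma small_for_finite: "finite E \<Longrightarrow> small_for W E"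
  by (simp add: small_for_def)

lemma small_for_infinite: "infinite W \<Longrightarrow> small_for W E \<longleftrightarrow> |E| \<le>o |W|"
  unfolding small_for_def
  by (meson card_of_ordLeq_infinite ordLeq_total card_of_Well_order)

lemma small_for_UN:
  assumes "\<And>w. w \<in> W \<Longrightarrow> small_for W (E w)"
  shows "small_for W (\<Union>w\<in>W. E w)"
proof (cases "finite W")
  case True
  then show ?thesis
    using assms by (auto simp: small_for_def)
next
  case False
  then show ?thesis
    using assms card_of_UNION_ordLeq_infinite[OF False card_of_mono1[OF subset_refl], of E]
    by (simp add: small_for_infinite)
qed

lemma small_for_Un:
  assumes "small_for W E" "small_for W F"
  shows "small_for W (E \<union> F)"
proof (cases "finite W")
  case True
  then show ?thesis
    using assms by (auto simp: small_for_def)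
next
  case False
  then show ?thesis
    using assms card_of_Un_ordLeq_infinite_Field[of "|W|" E F] card_of_Card_order[of W]
    by (simp add: small_for_infinite Field_card_of)
qed

lemma small_for_ordLess:
  assumes "small_for W E" "|W| <o |A|" "infinite A"
  shows "|E| <o |A|"
proof (cases "finite E")
  case True
  then show ?thesis
    using finite_ordLess_infinite[OF card_of_Well_order card_of_Well_order, of E A] assms(3)
    by (simp add: Field_card_of)
next
  case False
  then show ?thesis
    using assms(1,2) by (auto simp: small_for_def intro: ordLeq_ordLess_trans)
qed

text \<open>Each term of the prism jumps once, from \<open>j w\<close> to \<open>k b w\<close>. The
  germ of \<open>s\<close> at \<open>j w\<close> vanishes on a neighbourhood \<open>N\<close>, and
  by \<open>lim\<close> all but finitely many \<open>k b w\<close> lie in \<open>N\<close>; there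
  the germ at \<open>k b w\<close> vanishes too and is pulled back along \<open>k b\<close>. The
  exceptions for all \<open>w\<close>, at all depths of the recursion, are collected in
  \<open>E\<close>.\<close>

lemma prism_vanishes:
  fixes X :: "'a topology" and j :: "'w \<Rightarrow> 'a" and k :: "'b \<Rightarrow> 'w \<Rightarrow> 'a"
  assumes j: "continuous_map W X j"
    and k: "\<And>b. b \<in> B \<Longrightarrow> continuous_map W X (k b)"
    and lim: "\<And>w N. w \<in> topspace W \<Longrightarrow> openin X N \<Longrightarrow> j w \<in> N \<Longrightarrow> finite {b \<in> B. k b w \<notin> N}"
    and s: "godement_pow X (Suc m) V s (\<lambda>_. 0)"
  shows "\<exists>E. small_for (topspace W) E \<and>
    (\<forall>b\<in>B - E. godement_pow W m {w \<in> topspace W. j w \<in> V} (prism j (k b) s) (\<lambda>_. 0))"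
  using s
proof (induction m arbitrary: V s)
  case 0
  then show ?case
    using small_for_finite by (intro exI[of _ "{}"]) auto
next
  case (Suc m)
  define D where "D = {w \<in> topspace W. j w \<in> V}"
  \<comment> \<open>\<open>N\<close> and \<open>E\<close> are chosen for each \<open>w\<close>
    before \<open>b\<close>, so that the exceptional set does not depend on
    \<open>b\<close>.\<close>
  define good where "good w N E \<longleftrightarrow>
      openin X N \<and> j w \<in> N \<and> small_for (topspace W) E \<and>
      godement_pow X (Suc m) N (\<lambda>xs. s (j w # xs)) (\<lambda>_. 0) \<and>
      (\<forall>b\<in>B - E. k b w \<in> N \<and> godement_pow W m {w \<in> topspace W. j w \<in> N}
          (prism j (k b) (\<lambda>xs. s (j w # xs))) (\<lambda>_. 0))" for w N E
  have "\<exists>N E. good w N E" if "w \<in> D" for w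
  proof -
    obtain N where N: "openin X N" "j w \<in> N"
        "godement_pow X (Suc m) N (\<lambda>xs. s (j w # xs)) (\<lambda>_. 0)"
      using Suc.prems \<open>w \<in> D\<close> unfolding D_def godement_pow_Suc[of X "Suc m"] by blast
    obtain E where E: "small_for (topspace W) E"
        "\<forall>b\<in>B - E. godement_pow W m {w \<in> topspace W. j w \<in> N}
          (prism j (k b) (\<lambda>xs. s (j w # xs))) (\<lambda>_. 0)"
      using Suc.IH[OF N(3)] by blast
    have "small_for (topspace W) ({b \<in> B. k b w \<notin> N} \<union> E)"
      using lim[OF _ N(1,2)] \<open>w \<in> D\<close> E(1)
      by (auto simp: D_def intro!: small_for_Un intro: small_for_finite)
    with N E(2) show ?thesis
      unfolding good_def
      by (intro exI[of _ N] exI[of _ "{b \<in> B. k b w \<notin> N} \<union> E"]) auto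
  qed
  then obtain N E where "\<And>w. w \<in> D \<Longrightarrow> good w (N w) (E w)"
    by metis
  note NE = this[unfolded good_def]
  define E' where "E' = (\<Union>w\<in>topspace W. if w \<in> D then E w else {})"
  have "small_for (topspace W) E'"
    unfolding E'_def by (rule small_for_UN) (auto simp: NE small_for_finite)
  moreover have "godement_pow W (Suc m) D (prism j (k b) s) (\<lambda>_. 0)" if b: "b \<in> B - E'" for b
    unfolding godement_pow_Suc
  proof
    fix w assume w: "w \<in> D"
    then have bw: "b \<in> B - E w" and w_top: "w \<in> topspace W"
      using b by (auto simp: E'_def D_def)
    obtain M where M: "openin X M" "k b w \<in> M"
        "godement_pow X m M (\<lambda>xs. s (j w # k b w # xs)) (\<lambda>_. 0)"
      using NE[OF w] bw unfolding godement_pow_Suc by blast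
    \<comment> \<open>The first condition controls the term that jumps at \<open>w\<close>, the
      second one the terms that jump later.\<close>
    define Q where "Q = {v \<in> topspace W. k b v \<in> M} \<inter> {v \<in> topspace W. j v \<in> N w}"
    have "openin W Q"
      unfolding Q_def using b M(1) NE[OF w] j k
      by (intro openin_Int openin_continuous_map_preimage) auto
    moreover have "w \<in> Q"
      using w_top M(2) NE[OF w] by (simp add: Q_def)
    moreover have "godement_pow W m Q (\<lambda>ws. s (j w # k b w # map (k b) ws)) (\<lambda>_. 0)"
      using godement_pow_pullback[OF k M(3), of b] b
      by (auto simp: Q_def o_def elim: godement_pow_mono)
    moreover have "godement_pow W m Q (prism j (k b) (\<lambda>xs. s (j w # xs))) (\<lambda>_. 0)"
      using NE[OF w] bw by (auto simp: Q_def elim: godement_pow_mono)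
    ultimately have "godement_pow W m Q (\<lambda>ws. prism j (k b) s (w # ws)) (\<lambda>_. 0)"
      using godement_pow_combine[of W m Q "\<lambda>ws. s (j w # k b w # map (k b) ws)" "\<lambda>_. 0"
          "prism j (k b) (\<lambda>xs. s (j w # xs))" "\<lambda>_. 0" "(-)"] by simp
    with \<open>openin W Q\<close> \<open>w \<in> Q\<close>
    show "\<exists>Q. openin W Q \<and> w \<in> Q \<and> godement_pow W m Q
        (\<lambda>ws. prism j (k b) s (w # ws)) (\<lambda>ws. (\<lambda>_. 0) (w # ws))"
      by blast
  qed
  ultimately show ?case
    unfolding D_def by blast
qed

text \<open>In \<open>prism_homotopy\<close> the term with \<open>cobd z\<close> vanishes for most
  \<open>b\<close>, which leaves the coboundary of the prism of \<open>z\<close>. The cocycle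
  condition on \<open>z\<close> is imposed on \<open>V\<close>, which contains the image of the
  limit map \<open>j\<close>.\<close>

lemma restrictions_cohomologous:
  fixes X :: "'a topology" and j :: "'w \<Rightarrow> 'a" and k :: "'b \<Rightarrow> 'w \<Rightarrow> 'a"
  assumes j: "continuous_map W X j"
    and k: "\<And>b. b \<in> B \<Longrightarrow> continuous_map W X (k b)"
    and lim: "\<And>w N. w \<in> topspace W \<Longrightarrow> openin X N \<Longrightarrow> j w \<in> N \<Longrightarrow> finite {b \<in> B. k b w \<notin> N}"
    and z: "godement_pow X (Suc (Suc n)) V (cobd z) (\<lambda>_. 0)"
    and V: "j ` topspace W \<subseteq> V"
  shows "\<exists>E. small_for (topspace W) E \<and>
    (\<forall>b\<in>B - E. (\<lambda>ws. z (map (k b) ws) - z (map j ws)) \<in> coboundaries W n)"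
proof -
  have "{w \<in> topspace W. j w \<in> V} = topspace W"
    using V by blast
  then obtain E where E: "small_for (topspace W) E"
      "\<And>b. b \<in> B - E \<Longrightarrow> cochain_eq W n (prism j (k b) (cobd z)) (\<lambda>_. 0)"
    using prism_vanishes[OF j k lim z] by auto
  have "(\<lambda>ws. z (map (k b) ws) - z (map j ws)) \<in> coboundaries W n" if "b \<in> B - E" for b
  proof -
    have "cochain_eq W n (\<lambda>ws. cobd (prism j (k b) z) ws + prism j (k b) (cobd z) ws)
        (\<lambda>ws. cobd (prism j (k b) z) ws + 0)"
      by (rule godement_pow_combine[OF godement_pow_refl E(2)]) (use that in auto)
    then have *: "cochain_eq W n (\<lambda>ws. z (map (k b) ws) - z (map j ws)) (cobd (prism j (k b) z))"
      by (simp add: prism_homotopy)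
    show ?thesis
    proof (cases n)
      \<comment> \<open>Coboundaries of degree 0 have zero germs; here the coboundary of the prism
        is its value at \<open>[]\<close>, which is 0.\<close>
      case 0
      have "cochain_eq W 0 (cobd (prism j (k b) z)) (\<lambda>_. 0)"
        by (rule godement_pow_length) (auto simp: length_Suc_conv)
      with * 0 show ?thesis
        unfolding coboundaries_def by (auto intro: godement_pow_trans)
    next
      case (Suc m)
      with * show ?thesis
        by (auto simp: coboundaries_def)
    qed
  qed
  with E(1) show ?thesis
    by blast
qed


section \<open>Functions with invertible mixed differences\<close>

text \<open>A family of pairwise separated sets that is maximal by Zorn's lemma cannot be indexed by
  elements of \<open>A\<close>: a diagonal construction would add a further set.\<close>

lemma exists_large_separated_family:
  assumes A: "infinite A"
  shows "\<exists>\<F> :: 'b set set. cardSuc |A| \<le>o |\<F>| \<and>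
    (\<forall>S\<in>\<F>. \<forall>T\<in>\<F>. S \<noteq> T \<longrightarrow>
      |A| \<le>o |{a \<in> A. a \<in> S \<longleftrightarrow> a \<in> T}| \<and> |A| \<le>o |{a \<in> A. a \<in> S \<longleftrightarrow> a \<notin> T}| )"
proof -
  define sep where "sep S T \<longleftrightarrow>
    |A| \<le>o |{a \<in> A. a \<in> S \<longleftrightarrow> a \<in> T}| \<and> |A| \<le>o |{a \<in> A. a \<in> S \<longleftrightarrow> a \<notin> T}|" for S T
  have sep_sym: "sep S T \<longleftrightarrow> sep T S" for S T
  proof -
    have "{a \<in> A. a \<in> S \<longleftrightarrow> a \<in> T} = {a \<in> A. a \<in> T \<longleftrightarrow> a \<in> S}"
      "{a \<in> A. a \<in> S \<longleftrightarrow> a \<notin> T} = {a \<in> A. a \<in> T \<longleftrightarrow> a \<notin> S}" by auto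
    then show ?thesis by (simp add: sep_def)
  qed
  define \<P> where "\<P> = {\<F>. \<forall>S\<in>\<F>. \<forall>T\<in>\<F>. S \<noteq> T \<longrightarrow> sep S T}"
  have "\<exists>M\<in>\<P>. \<forall>X\<in>\<P>. M \<subseteq> X \<longrightarrow> X = M"
  proof (rule subset_Zorn')
    fix C assume C: "subset.chain \<P> C"
    then have "S \<noteq> T \<longrightarrow> sep S T" if ST: "S \<in> \<Union>C" "T \<in> \<Union>C" for S T
    proof -
      obtain F G where FG: "F \<in> C" "G \<in> C" "S \<in> F" "T \<in> G"
        using ST by blast
      with C have "F \<subseteq> G \<or> G \<subseteq> F" "F \<in> \<P>" "G \<in> \<P>"
        by (auto simp: subset_chain_def)
      then obtain H where "H \<in> \<P>" "S \<in> H" "T \<in> H"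
        using FG(3,4) by blast
      then show ?thesis
        by (simp add: \<P>_def)
    qed
    then show "\<Union>C \<in> \<P>" by (simp add: \<P>_def)
  qed
  then obtain \<F> where \<F>: "\<F> \<in> \<P>" and max: "\<And>X. X \<in> \<P> \<Longrightarrow> \<F> \<subseteq> X \<Longrightarrow> X = \<F>"
    by blast
  have "\<not> |\<F>| \<le>o |A|"
  proof
    assume "|\<F>| \<le>o |A|"
    then obtain i where i: "inj_on i \<F>" "i ` \<F> \<subseteq> A"
      using card_of_ordLeq[of \<F> A] by blast
    \<comment> \<open>\<open>A\<close> splits into copies of itself, two for each element of
      \<open>A\<close>; the injection \<open>i\<close> assigns to each member of \<open>\<F>\<close>
      its own pair of copies.\<close>
    have AA: "|A \<times> A| =o |A|"
      using A by (rule card_of_Times_same_infinite)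
    have "infinite (A \<times> A)"
      using A by (auto dest: finite_cartesian_productD1)
    moreover from this have "|UNIV :: bool set| \<le>o |A \<times> A|"
      using finite_ordLess_infinite[OF card_of_Well_order card_of_Well_order,
          of "UNIV :: bool set" "A \<times> A"] ordLess_imp_ordLeq by (auto simp: Field_card_of)
    ultimately have "|(A \<times> A) \<times> (UNIV :: bool set)| =o |A \<times> A|"
      using card_of_Times_infinite by blast
    then have "|(A \<times> A) \<times> (UNIV :: bool set)| =o |A|"
      using AA ordIso_transitive by blast
    then obtain p where p: "bij_betw p ((A \<times> A) \<times> (UNIV :: bool set)) A"
      using card_of_ordIso by blast
    text \<open>The copy \<open>{i T} \<times> A \<times> {True}\<close> of \<open>A\<close> serves to make \<open>S\<close> agree with \<open>T\<close>, the copy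
      \<open>{i T} \<times> A \<times> {False}\<close> to make it differ.\<close>
    define S where "S = p ` {((i T, v), e) | T v e. T \<in> \<F> \<and> v \<in> A \<and> (p ((i T, v), e) \<in> T \<longleftrightarrow> e)}"
    have mem: "p ((i T, v), e) \<in> S \<longleftrightarrow> (p ((i T, v), e) \<in> T \<longleftrightarrow> e)" if "T \<in> \<F>" "v \<in> A" for T v e
    proof
      assume "p ((i T, v), e) \<in> S"
      then obtain T' v' e' where *: "p ((i T, v), e) = p ((i T', v'), e')" "T' \<in> \<F>" "v' \<in> A"
          "p ((i T', v'), e') \<in> T' \<longleftrightarrow> e'"
        by (auto simp: S_def)
      then have "((i T, v), e) = ((i T', v'), e')"
        using inj_onD[OF bij_betw_imp_inj_on[OF p] *(1)] that i(2) by blast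
      with * show "p ((i T, v), e) \<in> T \<longleftrightarrow> e"
        using inj_onD[OF i(1), of T T'] that by auto
    qed (use that in \<open>auto simp: S_def\<close>)
    have sep_S: "sep S T" if T: "T \<in> \<F>" for T
    proof -
      have copy: "|A| \<le>o |C|" if "(\<lambda>v. p ((i T, v), e)) ` A \<subseteq> C" for e C
      proof -
        have "inj_on (\<lambda>v. p ((i T, v), e)) A"
          using inj_onD[OF bij_betw_imp_inj_on[OF p]] T i(2) by (intro inj_onI) blast
        with that show ?thesis
          using card_of_ordLeq by blast
      qed
      have in_A: "p ((i T, v), e) \<in> A" if "v \<in> A" for v e
        using bij_betwE[OF p] T i(2) that by blast
      show ?thesis
        unfolding sep_def
        by (intro conjI copy[of True] copy[of False]) (use mem[OF T] in_A in auto)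
    qed
    \<comment> \<open>Otherwise \<open>S\<close> would be separated from itself, but it differs from
      itself nowhere.\<close>
    have "S \<notin> \<F>"
    proof
      assume "S \<in> \<F>"
      then have "|A| \<le>o |{} :: 'b set|"
        using sep_S[of S] by (simp add: sep_def)
      with A show False
        using card_of_ordLeq_finite by blast
    qed
    moreover have "insert S \<F> \<in> \<P>"
      using \<F> sep_S sep_sym by (auto simp: \<P>_def)
    ultimately show False
      using max[of "insert S \<F>"] by blast
  qed
  then have "|A| <o |\<F>|"
    using ordLess_or_ordLeq[OF card_of_Well_order card_of_Well_order] by blast
  then have "cardSuc |A| \<le>o |\<F>|"
    using cardSuc_ordLess_ordLeq[OF card_of_Card_order card_of_Card_order] by blast
  with \<F> show ?thesis
    by (auto simp: \<P>_def sep_def)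
qed

text \<open>The order of the quantifiers follows the use: \<open>E\<close> collects the exceptional
  \<open>b\<close> for all \<open>a \<in> A\<close>, whereas \<open>D\<close> collects the
  exceptional \<open>a\<close> for the two chosen \<open>b\<close> and \<open>b'\<close> and thus
  depends on them.\<close>

definition unit_mixed_difference ::
    "'b set \<Rightarrow> 'c set \<Rightarrow> ('b \<Rightarrow> 'c \<Rightarrow> 'r::comm_ring_1) \<Rightarrow> bool" where
  "unit_mixed_difference A B f \<longleftrightarrow>
    (\<forall>E. |E| \<le>o |A| \<longrightarrow> (\<exists>b\<in>B - E. \<exists>b'\<in>B - E. \<forall>D. |D| <o |A| \<longrightarrow>
      (\<exists>a\<in>A - D. \<exists>a'\<in>A - D. f a b - f a b' - f a' b + f a' b' dvd 1)))"

lemma two_points_outside: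
  assumes "infinite A" "|A| <o |B|" "|E| \<le>o |A|"
  shows "\<exists>b\<in>B - E. \<exists>b'\<in>B - E. b \<noteq> b'"
proof (rule ccontr)
  assume "\<not> ?thesis"
  then obtain b where "B \<subseteq> insert b E"
    by blast
  then have "|B| \<le>o |{b} \<union> E|"
    by (intro card_of_mono1) auto
  also have "|{b} \<union> E| \<le>o |A|"
    using card_of_Un_ordLeq_infinite_Field[of "|A|" "{b}" E] card_of_Card_order[of A] assms(1,3)
      card_of_singl_ordLeq[of A b] by (auto simp: Field_card_of)
  finally show False
    using assms(2) not_ordLess_ordLeq by blast
qed

lemma exists_unit_mixed_difference:
  assumes A: "infinite A" and B: "|B| =o cardSuc |A|"
  shows "\<exists>f :: 'b \<Rightarrow> 'c \<Rightarrow> 'r::comm_ring_1. unit_mixed_difference A B f"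
proof -
  obtain \<F> :: "'b set set" where "cardSuc |A| \<le>o |\<F>|" and \<F>:
    "\<And>S T. S \<in> \<F> \<Longrightarrow> T \<in> \<F> \<Longrightarrow> S \<noteq> T \<Longrightarrow>
      |A| \<le>o |{a \<in> A. a \<in> S \<longleftrightarrow> a \<in> T}| \<and> |A| \<le>o |{a \<in> A. a \<in> S \<longleftrightarrow> a \<notin> T}|"
    using exists_large_separated_family[OF A] by blast
  then have "|B| \<le>o |\<F>|"
    using B ordIso_ordLeq_trans by blast
  then obtain g where g: "inj_on g B" "g ` B \<subseteq> \<F>"
    using card_of_ordLeq[of B \<F>] by blast
  have AB: "|A| <o |B|"
    using B cardSuc_greater[OF card_of_Card_order] ordLess_ordIso_trans ordIso_symmetric by blast
  define f :: "'b \<Rightarrow> 'c \<Rightarrow> 'r" where "f a b = of_bool (a \<in> g b)" for a b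
  have "\<exists>a\<in>A - D. \<exists>a'\<in>A - D. f a b - f a b' - f a' b + f a' b' dvd 1"
    if b: "b \<in> B" "b' \<in> B" "b \<noteq> b'" and D: "|D| <o |A|" for b b' D
  proof -
    have large: "\<exists>a\<in>C. a \<notin> D" if "|A| \<le>o |C|" for C
      using that D card_of_mono1[of C D] not_ordLess_ordLeq ordLeq_transitive by blast
    have "g b \<in> \<F>" "g b' \<in> \<F>" "g b \<noteq> g b'"
      using b g by (auto dest: inj_onD)
    \<comment> \<open>At \<open>a\<close> the values for \<open>b\<close> and \<open>b'\<close>
      agree and contribute 0; at \<open>a'\<close> they differ and contribute 1 or -1.\<close>
    from \<F>[OF this] obtain a a' where "a \<in> A - D" "a \<in> g b \<longleftrightarrow> a \<in> g b'"
        "a' \<in> A - D" "a' \<in> g b \<longleftrightarrow> a' \<notin> g b'"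
      using large by blast
    then show ?thesis
      by (intro bexI[of _ a] bexI[of _ a']) (auto simp: f_def)
  qed
  then have "unit_mixed_difference A B f"
    unfolding unit_mixed_difference_def using two_points_outside[OF A AB]
    by (meson DiffD1)
  then show ?thesis by blast
qed


section \<open>Locally compact zero-dimensional spaces\<close>

text \<open>A local form of local profiniteness, which passes directly to products and open
  subspaces.\<close>

definition locally_compact_zero_dim :: "'a topology \<Rightarrow> bool" where
  "locally_compact_zero_dim X \<longleftrightarrow> Hausdorff_space X \<and>
    (\<forall>V. \<forall>x\<in>V. openin X V \<longrightarrow> (\<exists>K\<subseteq>V. x \<in> K \<and> compactin X K \<and> openin X K))"

text \<open>A compact open subset of \<open>X\<close> is clopen in the one-point compactification;
  such sets separate a point of \<open>X\<close> from every other point, including the added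
  one.\<close>

lemma locally_compact_zero_dim_imp_locally_profinite_space:
  assumes "locally_compact_zero_dim X"
  shows "locally_profinite_space X"
proof -
  let ?P = "Alexandroff_compactification X"
  have X: "Hausdorff_space X"
      "\<And>V x. openin X V \<Longrightarrow> x \<in> V \<Longrightarrow> \<exists>K\<subseteq>V. x \<in> K \<and> compactin X K \<and> openin X K"
    using assms by (auto simp: locally_compact_zero_dim_def)
  have "locally_compact_space X"
    unfolding locally_compact_space_def using X(2)[OF openin_topspace] by blast
  with X(1) have "Hausdorff_space ?P"
    by (simp add: Hausdorff_space_Alexandroff_compactification)
  moreover have "totally_disconnected_space ?P"
    unfolding totally_disconnected_space_def
  proof (intro allI impI)
    fix S assume S: "connectedin ?P S"
    have no_pair: False if pq: "Some x \<in> S" "q \<in> S" "q \<noteq> Some x" for x q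
    proof -
      have x: "x \<in> topspace X"
        using connectedin_subset_topspace[OF S] pq(1) by auto
      \<comment> \<open>For \<open>q = None\<close> nothing is removed, since every \<open>K\<close>
        inside \<open>X\<close> avoids the added point.\<close>
      have "openin X (topspace X - {y. q = Some y})"
      proof (cases q)
        case (Some y)
        have "closedin X {y. q = Some y}"
          using connectedin_subset_topspace[OF S] pq(2) Some
          by (auto simp: X(1) closedin_Hausdorff_singleton)
        then show ?thesis by blast
      qed simp
      then obtain K where K: "K \<subseteq> topspace X - {y. q = Some y}" "x \<in> K" "compactin X K" "openin X K"
        using X(2) x pq(3) by (metis (mono_tags, lifting) DiffI mem_Collect_eq)
      have "closedin X K"
        using K(3) X(1) compactin_imp_closedin by blast
      then have "openin ?P (insert None (Some ` (topspace X - K)))"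
        using K(3) by (auto simp: openin_Alexandroff_compactification)
      moreover have "insert None (Some ` (topspace X - K)) = topspace ?P - Some ` K"
        by auto
      ultimately have "closedin ?P (Some ` K)"
        using K(1) by (auto simp: closedin_def)
      then have "S \<subseteq> Some ` K \<or> disjnt S (Some ` K)"
        using K(4) by (intro connectedin_clopen_cases[OF S]) auto
      then show False
        using K(1,2) pq by (auto simp: disjnt_iff)
    qed
    show "\<exists>a. S \<subseteq> {a}"
      using no_pair by (metis insertCI not_Some_eq subsetI singletonD)
  qed
  ultimately have P: "profinite_space ?P"
    by (simp add: profinite_space_def)
  have "topspace ?P - {None} = Some ` topspace X"
    by auto
  then have "X homeomorphic_space subtopology ?P (topspace ?P - {None})"
    using embedding_map_imp_homeomorphic_space[OF embedding_map_Some] by simp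
  with P show ?thesis
    by (intro locally_profinite_spaceI[of ?P None]) auto
qed

lemma locally_compact_zero_dim_homeomorphic_space:
  assumes hom: "X homeomorphic_space Y" and X: "locally_compact_zero_dim X"
  shows "locally_compact_zero_dim Y"
  unfolding locally_compact_zero_dim_def
proof (intro conjI allI ballI impI)
  show "Hausdorff_space Y"
    using X homeomorphic_Hausdorff_space[OF hom] by (simp add: locally_compact_zero_dim_def)
  obtain f where f: "homeomorphic_map X Y f"
    using hom homeomorphic_space by blast
  fix V y assume V: "y \<in> V" "openin Y V"
  have top: "f ` topspace X = topspace Y"
    using f by (rule homeomorphic_imp_surjective_map)
  let ?U = "{x \<in> topspace X. f x \<in> V}"
  have "openin X ?U"
    using homeomorphic_imp_continuous_map[OF f] V(2) by (rule openin_continuous_map_preimage)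
  moreover have "y \<in> f ` topspace X"
    using openin_subset[OF V(2)] V(1) top by auto
  then obtain x where x: "x \<in> ?U" "f x = y"
    using V(1) by auto
  ultimately obtain K where K: "K \<subseteq> ?U" "x \<in> K" "compactin X K" "openin X K"
    using X unfolding locally_compact_zero_dim_def by meson
  then have "compactin Y (f ` K)" "openin Y (f ` K)"
    using homeomorphic_map_compactness_eq[OF f] homeomorphic_map_openness_eq[OF f] by blast+
  then show "\<exists>K\<subseteq>V. y \<in> K \<and> compactin Y K \<and> openin Y K"
    using K x by (intro exI[of _ "f ` K"]) auto
qed

lemma locally_compact_zero_dim_prod_topology:
  assumes X: "locally_compact_zero_dim X" and Y: "locally_compact_zero_dim Y"
  shows "locally_compact_zero_dim (prod_topology X Y)"
  unfolding locally_compact_zero_dim_def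
proof (intro conjI allI ballI impI)
  show "Hausdorff_space (prod_topology X Y)"
    using X Y by (simp add: locally_compact_zero_dim_def Hausdorff_space_prod_topology)
  fix V p assume p: "p \<in> V" and V: "openin (prod_topology X Y) V"
  obtain x y where xy: "p = (x, y)"
    by fastforce
  with p V obtain U W where UW: "openin X U" "openin Y W" "x \<in> U" "y \<in> W" "U \<times> W \<subseteq> V"
    unfolding openin_prod_topology_alt by meson
  obtain K where K: "K \<subseteq> U" "x \<in> K" "compactin X K" "openin X K"
    using X UW(1,3) unfolding locally_compact_zero_dim_def by meson
  obtain L where L: "L \<subseteq> W" "y \<in> L" "compactin Y L" "openin Y L"
    using Y UW(2,4) unfolding locally_compact_zero_dim_def by meson
  have "compactin (prod_topology X Y) (K \<times> L)" "openin (prod_topology X Y) (K \<times> L)"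
    using K L by (simp_all add: compactin_Times openin_prod_Times_iff)
  then show "\<exists>K\<subseteq>V. p \<in> K \<and> compactin (prod_topology X Y) K \<and> openin (prod_topology X Y) K"
    using K L UW xy by (intro exI[of _ "K \<times> L"]) auto
qed

lemma locally_compact_zero_dim_open_subtopology:
  assumes X: "locally_compact_zero_dim X" and U: "openin X U"
  shows "locally_compact_zero_dim (subtopology X U)"
  unfolding locally_compact_zero_dim_def
proof (intro conjI allI ballI impI)
  show "Hausdorff_space (subtopology X U)"
    using X by (simp add: locally_compact_zero_dim_def Hausdorff_space_subtopology)
  fix V x assume x: "x \<in> V" and V: "openin (subtopology X U) V"
  then have "openin X V" "V \<subseteq> U"
    using U by (simp_all add: openin_open_subtopology)
  with X x obtain K where "K \<subseteq> V" "x \<in> K" "compactin X K" "openin X K"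
    unfolding locally_compact_zero_dim_def by meson
  with \<open>V \<subseteq> U\<close> U show "\<exists>K\<subseteq>V. x \<in> K \<and> compactin (subtopology X U) K \<and> openin (subtopology X U) K"
    by (intro exI[of _ K]) (auto simp: compactin_subtopology openin_open_subtopology)
qed

lemma locally_compact_zero_dim_discrete: "locally_compact_zero_dim (discrete_topology S)"
  unfolding locally_compact_zero_dim_def
proof (intro conjI allI ballI impI)
  show "Hausdorff_space (discrete_topology S)" by simp
  fix V x assume "x \<in> V" "openin (discrete_topology S) V"
  then show "\<exists>K\<subseteq>V. x \<in> K \<and> compactin (discrete_topology S) K \<and> openin (discrete_topology S) K"
    by (intro exI[of _ "{x}"]) (auto simp: compactin_discrete_topology)
qed


section \<open>The plank\<close>

text \<open>Equality of germs is local in the first entry of the tuple, so cocycle conditions can be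
  checked on a covering.\<close>

lemma godement_pow_Un:
  "godement_pow X (Suc m) V s t \<Longrightarrow> godement_pow X (Suc m) V' s t \<Longrightarrow>
    godement_pow X (Suc m) (V \<union> V') s t"
  unfolding godement_pow_Suc by blast

abbreviation one_point :: "'b set \<Rightarrow> 'b option topology" where
  "one_point A \<equiv> Alexandroff_compactification (discrete_topology A)"

lemma openin_one_point:
  "openin (one_point A) V \<longleftrightarrow> V \<subseteq> insert None (Some ` A) \<and> (None \<in> V \<longrightarrow> finite {a \<in> A. Some a \<notin> V})"
proof
  assume "openin (one_point A) V"
  then show "V \<subseteq> insert None (Some ` A) \<and> (None \<in> V \<longrightarrow> finite {a \<in> A. Some a \<notin> V})"
    unfolding openin_Alexandroff_compactification compactin_discrete_topology
    by (auto simp: image_iff elim: rev_finite_subset)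
next
  assume V: "V \<subseteq> insert None (Some ` A) \<and> (None \<in> V \<longrightarrow> finite {a \<in> A. Some a \<notin> V})"
  show "openin (one_point A) V"
  proof (cases "None \<in> V")
    case True
    with V have "V = insert None (Some ` (A - {a \<in> A. Some a \<notin> V}))"
      by auto
    with True V show ?thesis
      unfolding openin_Alexandroff_compactification compactin_discrete_topology
      by (intro disjI2 exI[of _ "{a \<in> A. Some a \<notin> V}"]) auto
  next
    case False
    with V have "V = Some ` {a \<in> A. Some a \<in> V}"
      by auto
    with V show ?thesis
      unfolding openin_Alexandroff_compactification
      by (intro disjI1 exI[of _ "{a \<in> A. Some a \<in> V}"]) auto
  qed
qed

definition plank :: "'b set \<Rightarrow> 'c set \<Rightarrow> ('b option \<times> 'c option) topology" where
  "plank A B = subtopology (prod_topology (one_point A) (one_point B)) (- {(None, None)})"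

lemma topspace_plank:
  "topspace (plank A B) = insert None (Some ` A) \<times> insert None (Some ` B) - {(None, None)}"
  by (auto simp: plank_def)

lemma openin_plank_fst: "openin (plank A B) {x \<in> topspace (plank A B). fst x \<in> Some ` A}"
proof -
  have "continuous_map (plank A B) (one_point A) fst"
    unfolding plank_def by (intro continuous_map_from_subtopology continuous_map_fst)
  then show ?thesis
    by (rule openin_continuous_map_preimage) (auto simp: openin_one_point)
qed

lemma openin_plank_snd: "openin (plank A B) {x \<in> topspace (plank A B). snd x \<in> Some ` B}"
proof -
  have "continuous_map (plank A B) (one_point B) snd"
    unfolding plank_def by (intro continuous_map_from_subtopology continuous_map_snd)
  then show ?thesis
    by (rule openin_continuous_map_preimage) (auto simp: openin_one_point)
qed

lemma openin_plank_point: "a \<in> A \<Longrightarrow> b \<in> B \<Longrightarrow> openin (plank A B) {(Some a, Some b)}"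
proof -
  assume "a \<in> A" "b \<in> B"
  then have "openin (prod_topology (one_point A) (one_point B)) ({Some a} \<times> {Some b})"
    by (subst openin_prod_Times_iff) (auto simp: openin_one_point)
  then show ?thesis
    unfolding plank_def openin_subtopology by (intro exI[of _ "{Some a} \<times> {Some b}"]) auto
qed

lemma continuous_map_into_plank:
  assumes "continuous_map Y (one_point A) p" "continuous_map Y (one_point B) q"
    "\<And>y. y \<in> topspace Y \<Longrightarrow> p y \<noteq> None \<or> q y \<noteq> None"
  shows "continuous_map Y (plank A B) (\<lambda>y. (p y, q y))"
  using assms unfolding plank_def
  by (auto simp: continuous_map_in_subtopology continuous_map_pairedI)

lemma openin_plank_compl:
  "openin (prod_topology (one_point A) (one_point B))
    (- {(None, None)} \<inter> topspace (prod_topology (one_point A) (one_point B)))"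
proof -
  have "openin (prod_topology (one_point A) (one_point B))
      ((Some ` A) \<times> topspace (one_point B) \<union> topspace (one_point A) \<times> (Some ` B))"
    by (intro openin_Un) (auto simp: openin_prod_Times_iff openin_one_point inj_image_mem_iff)
  moreover have "(Some ` A) \<times> topspace (one_point B) \<union> topspace (one_point A) \<times> (Some ` B) =
      - {(None, None)} \<inter> topspace (prod_topology (one_point A) (one_point B))"
    by auto
  ultimately show ?thesis by metis
qed

text \<open>An open set around \<open>None\<close> omits finitely many isolated points, so it is
  clopen and hence compact; all other points are isolated.\<close>

lemma locally_compact_zero_dim_one_point: "locally_compact_zero_dim (one_point A)"
  unfolding locally_compact_zero_dim_def
proof (intro conjI allI ballI impI)
  have "locally_compact_space (discrete_topology A)"
    by (simp add: locally_compact_space_discrete_topology)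
  then show Haus: "Hausdorff_space (one_point A)"
    by (simp add: Hausdorff_space_Alexandroff_compactification)
  fix V x assume x: "x \<in> V" and V: "openin (one_point A) V"
  have V_sub: "V \<subseteq> insert None (Some ` A)"
    using V by (simp add: openin_one_point)
  show "\<exists>K\<subseteq>V. x \<in> K \<and> compactin (one_point A) K \<and> openin (one_point A) K"
  proof (cases x)
    case None
    have "openin (one_point A) (insert None (Some ` A) - V)"
      using None x by (auto simp: openin_one_point)
    then have "closedin (one_point A) V"
      using V_sub by (simp add: closedin_def)
    then have "compactin (one_point A) V"
      by (simp add: closedin_compact_space)
    with x V show ?thesis by blast
  next
    case (Some a)
    then show ?thesis
      using x V_sub by (intro exI[of _ "{x}"]) (auto simp: openin_one_point)
  qed
qed

lemma locally_compact_zero_dim_plank: "locally_compact_zero_dim (plank A B)"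
proof -
  have "plank A B = subtopology (prod_topology (one_point A) (one_point B))
      (- {(None, None)} \<inter> topspace (prod_topology (one_point A) (one_point B)))"
    unfolding plank_def by (metis subtopology_restrict Int_commute)
  then show ?thesis
    using locally_compact_zero_dim_open_subtopology[OF _ openin_plank_compl]
      locally_compact_zero_dim_prod_topology locally_compact_zero_dim_one_point by metis
qed

text \<open>The Cech 1-cocycle \<open>f\<close> is turned into a Godement cocycle by choosing for each point one of the two
  open sets that contains it, namely the set where the first coordinate is finite if possible.\<close>

definition plank_fun :: "('b \<Rightarrow> 'c \<Rightarrow> 'r::comm_ring_1) \<Rightarrow> 'b option \<times> 'c option \<Rightarrow> 'r" where
  "plank_fun f x = (case x of (Some a, Some b) \<Rightarrow> f a b | _ \<Rightarrow> 0)"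

definition plank_cocycle ::
    "('b \<Rightarrow> 'c \<Rightarrow> 'r::comm_ring_1) \<Rightarrow> ('b option \<times> 'c option) list \<Rightarrow> 'r" where
  "plank_cocycle f xs = (if fst (xs ! 0) = None then plank_fun f (xs ! 1) else 0)"

lemma plank_cocycle_eq_0:
  "length xs = 2 \<Longrightarrow> set xs \<subseteq> {x \<in> topspace (plank A B). fst x \<in> Some ` A} \<Longrightarrow>
    plank_cocycle f xs = 0"
  by (cases xs) (auto simp: plank_cocycle_def)

text \<open>If the first coordinate of \<open>x\<close> is \<open>None\<close>, then
  \<open>plank_fun f x\<close> is 0, so the coboundary at \<open>[x, y]\<close> is the value at
  \<open>y\<close>. Every other point \<open>x\<close> of this set is isolated, and both sides
  vanish at \<open>[x, x]\<close>.\<close>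

lemma plank_cocycle_eq_cobd:
  "godement_pow (plank A B) 2 {x \<in> topspace (plank A B). snd x \<in> Some ` B}
    (plank_cocycle f) (cobd (\<lambda>xs. plank_fun f (xs ! 0)))"
  unfolding numeral_2_eq_2 godement_pow_Suc[of _ "Suc 0"]
proof
  fix x assume x: "x \<in> {x \<in> topspace (plank A B). snd x \<in> Some ` B}"
  let ?G = "\<lambda>W. openin (plank A B) W \<and> x \<in> W \<and> godement_pow (plank A B) (Suc 0) W
    (\<lambda>xs. plank_cocycle f (x # xs)) (\<lambda>xs. cobd (\<lambda>xs. plank_fun f (xs ! 0)) (x # xs))"
  show "\<exists>W. ?G W"
  proof (cases "fst x")
    case None
    then have "?G (topspace (plank A B))"
      using x by (auto simp: plank_cocycle_def plank_fun_def length_Suc_conv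
          intro!: godement_pow_length split: prod.splits)
    then show ?thesis ..
  next
    case (Some a)
    with x obtain b where "x = (Some a, Some b)" "a \<in> A" "b \<in> B"
      by (auto simp: topspace_plank)
    then have "?G {x}"
      by (auto simp: openin_plank_point plank_cocycle_def length_Suc_conv intro!: godement_pow_on)
    then show ?thesis ..
  qed
qed

text \<open>The two open sets cover the plank because \<open>(None, None)\<close> is removed; the
  cochain is zero on one and a coboundary on the other.\<close>

lemma plank_cocycle: "plank_cocycle f \<in> cocycles (plank A B) 1"
proof -
  let ?V0 = "{x \<in> topspace (plank A B). fst x \<in> Some ` A}"
  let ?V1 = "{x \<in> topspace (plank A B). snd x \<in> Some ` B}"
  have "godement_pow (plank A B) 2 ?V0 (plank_cocycle f) (\<lambda>_. 0)"
    by (rule godement_pow_on[OF openin_plank_fst]) (rule plank_cocycle_eq_0)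
  then have "godement_pow (plank A B) (Suc 2) ?V0 (cobd (plank_cocycle f)) (\<lambda>_. 0)"
    using cobd_cong[OF openin_plank_fst] by fastforce
  moreover have "cobd (cobd (\<lambda>xs. plank_fun f (xs ! 0))) = (\<lambda>_. 0)"
    by (rule ext) (rule cobd_cobd)
  then have "godement_pow (plank A B) (Suc 2) ?V1 (cobd (plank_cocycle f)) (\<lambda>_. 0)"
    using cobd_cong[OF openin_plank_snd plank_cocycle_eq_cobd[where f = f], of A B] by simp
  ultimately have "godement_pow (plank A B) (Suc 2) (?V0 \<union> ?V1) (cobd (plank_cocycle f)) (\<lambda>_. 0)"
    by (rule godement_pow_Un)
  moreover have "?V0 \<union> ?V1 = topspace (plank A B)"
    by (auto simp: topspace_plank)
  ultimately show ?thesis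
    by (simp add: cocycles_def numeral_2_eq_2)
qed

section \<open>Cup product with the class of a plank\<close>

lemma cup_plank_cocycle_not_coboundary:
  fixes W :: "'w topology" and A :: "'b set" and B :: "'c set" and c :: "'w list \<Rightarrow> 'r::comm_ring_1"
  assumes c: "c \<in> cocycles W n" "c \<notin> coboundaries W n"
    and A: "infinite A" "|topspace W| <o |A|"
    and f: "unit_mixed_difference A B f"
  shows "cup_cochain n (c \<circ> map fst) (plank_cocycle f \<circ> map snd)
    \<notin> coboundaries (prod_topology W (plank A B)) (Suc n)"
proof
  define X where "X = prod_topology W (plank A B)"
  let ?c = "c \<circ> map fst :: ('w \<times> 'b option \<times> 'c option) list \<Rightarrow> 'r"
  let ?e = "plank_cocycle f \<circ> map snd :: ('w \<times> 'b option \<times> 'c option) list \<Rightarrow> 'r"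
  let ?F = "(\<lambda>xs. plank_fun f (xs ! 0)) \<circ> map snd :: ('w \<times> 'b option \<times> 'c option) list \<Rightarrow> 'r"
  assume "cup_cochain n ?c ?e \<in> coboundaries (prod_topology W (plank A B)) (Suc n)"
  then obtain h where h: "cochain_eq X (Suc n) (cup_cochain n ?c ?e) (cobd h)"
    by (auto simp: coboundaries_def X_def)
  define V0 where "V0 = {x \<in> topspace X. snd x \<in> {x \<in> topspace (plank A B). fst x \<in> Some ` A}}"
  define V1 where "V1 = {x \<in> topspace X. snd x \<in> {x \<in> topspace (plank A B). snd x \<in> Some ` B}}"
  have snd: "continuous_map X (plank A B) snd" and fst: "continuous_map X W fst"
    by (simp_all add: X_def continuous_map_fst continuous_map_snd)
  have V0: "openin X V0" and V1: "openin X V1"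
    unfolding V0_def V1_def
    by (intro openin_continuous_map_preimage[OF snd] openin_plank_fst openin_plank_snd)+
  have h': "godement_pow X (Suc (Suc n)) V (cup_cochain n ?c ?e) (cobd h)" if "openin X V" for V
    using h by (rule godement_pow_mono) (rule openin_subset[OF that])
  \<comment> \<open>The factor \<open>?e\<close> is evaluated at the last two points, both in
    \<open>V0\<close>, where it vanishes; so \<open>h\<close> is a cocycle there.\<close>
  have "godement_pow X (Suc (Suc n)) V0 (cup_cochain n ?c ?e) (\<lambda>_. 0)"
  proof (rule godement_pow_on[OF V0])
    fix xs assume xs: "length xs = Suc (Suc n)" "set xs \<subseteq> V0"
    have "set (drop n xs) \<subseteq> V0"
      using xs(2) set_drop_subset by fast
    with xs(1) have "plank_cocycle f (map snd (drop n xs)) = 0"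
      by (intro plank_cocycle_eq_0[of _ A B]) (auto simp: V0_def)
    then show "cup_cochain n ?c ?e xs = 0"
      by (simp add: cup_cochain_def)
  qed
  then have h0: "godement_pow X (Suc (Suc n)) V0 (cobd h) (\<lambda>_. 0)"
    using godement_pow_trans godement_pow_sym h'[OF V0] by blast
  \<comment> \<open>On \<open>V1\<close> the factor \<open>?e\<close> is the coboundary of
    \<open>?F\<close>, so by the Leibniz rule \<open>cup_cochain n ?c ?F\<close> is, up to the sign
    \<open>(-1) ^ n\<close>, another primitive of the product besides \<open>h\<close>.\<close>
  define z where "z = (\<lambda>xs. h xs - (-1) ^ n * cup_cochain n ?c ?F xs)"
  have h1: "godement_pow X (Suc (Suc n)) V1 (cobd z) (\<lambda>_. 0)"
  proof -
    have "cochain_eq X (Suc n) (cobd ?c) (\<lambda>_. 0)"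
      using cocycles_pullback[OF fst c(1)] by (simp add: cocycles_def)
    then have "godement_pow X (Suc (Suc n)) V1 (cobd ?c) (\<lambda>_. 0)"
      by (rule godement_pow_mono) (rule openin_subset[OF V1])
    from cup_cochain_cong[OF V1 this godement_pow_refl[OF V1], of 0 ?F]
    have 1: "godement_pow X (Suc (Suc n)) V1 (cup_cochain (Suc n) (cobd ?c) ?F) (\<lambda>_. 0)"
      by (simp add: cup_cochain_def[abs_def])
    have "godement_pow X (Suc (Suc 0)) V1 ?e (cobd ?F)"
      using godement_pow_pullback[OF snd plank_cocycle_eq_cobd[where f = f]]
      by (simp add: V1_def cobd_map numeral_2_eq_2)
    from cup_cochain_cong[OF V1 godement_pow_refl[OF V1] this, of n ?c]
    have 2: "godement_pow X (Suc (Suc n)) V1 (cup_cochain n ?c (cobd ?F)) (cobd h)"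
      using h'[OF V1] by (auto intro: godement_pow_sym godement_pow_trans)
    have "cochain_eq X (Suc n) (cobd (cup_cochain n ?c ?F))
        (\<lambda>xs. cup_cochain (Suc n) (cobd ?c) ?F xs + (-1) ^ n * cup_cochain n ?c (cobd ?F) xs)"
      using cobd_cup_cochain_eq[of X n 0] by simp
    then have "godement_pow X (Suc (Suc n)) V1 (cobd (cup_cochain n ?c ?F))
        (\<lambda>xs. cup_cochain (Suc n) (cobd ?c) ?F xs + (-1) ^ n * cup_cochain n ?c (cobd ?F) xs)"
      by (rule godement_pow_mono) (rule openin_subset[OF V1])
    from godement_pow_trans[OF this godement_pow_combine[OF 1 2, of "\<lambda>a b. a + (-1) ^ n * b"]]
    have "godement_pow X (Suc (Suc n)) V1 (cobd (cup_cochain n ?c ?F)) (\<lambda>xs. (-1) ^ n * cobd h xs)"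
      by simp
    from godement_pow_combine[OF godement_pow_refl[OF V1, of _ "cobd h"] this,
        of "\<lambda>a b. a - (-1) ^ n * b"]
    show ?thesis
      by (simp add: z_def cobd_diff cobd_scale mult.assoc[symmetric] power_add[symmetric]
          mult_2[symmetric])
  qed
  define j where "j u v w = (w, u, v)" for u :: "'b option" and v :: "'c option" and w :: 'w
  have j: "continuous_map W X (j u v)" if "(u, v) \<in> topspace (plank A B)" for u v
    unfolding j_def X_def using that by (intro continuous_map_pairedI) (auto simp: topspace_plank)
  \<comment> \<open>The slices at \<open>(Some a, Some b)\<close> and \<open>(Some a, None)\<close>
    both lie in \<open>V0\<close>, where \<open>h\<close> is a cocycle; those compared by
    \<open>z2\<close> lie in \<open>V1\<close>, where \<open>z\<close> is one.\<close>
  define h2 where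
    "h2 a b = (\<lambda>ws. h (map (j (Some a) (Some b)) ws) - h (map (j (Some a) None) ws))" for a b
  have horizontal: "\<exists>E. small_for (topspace W) E \<and> (\<forall>b\<in>B - E. h2 a b \<in> coboundaries W n)"
    if a: "a \<in> A" for a
    unfolding h2_def
  proof (rule restrictions_cohomologous[OF _ _ _ h0])
    fix w N assume w: "w \<in> topspace W" and N: "openin X N" "j (Some a) None w \<in> N"
    \<comment> \<open>By continuity the preimage of \<open>N\<close> is a neighbourhood of
      \<open>None\<close> in \<open>one_point B\<close>, which misses finitely many
      \<open>b\<close>.\<close>
    have "continuous_map (one_point B) X (\<lambda>v. (w, Some a, v))"
      unfolding X_def using w a
      by (intro continuous_map_pairedI continuous_map_into_plank) auto
    from openin_continuous_map_preimage[OF this N(1)] N(2)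
    show "finite {b \<in> B. j (Some a) (Some b) w \<notin> N}"
      by (auto simp: openin_one_point j_def elim: rev_finite_subset)
  qed (use a j in \<open>auto simp: topspace_plank V0_def j_def X_def\<close>)
  define z2 where
    "z2 a b = (\<lambda>ws. z (map (j (Some a) (Some b)) ws) - z (map (j None (Some b)) ws))" for a b
  have vertical: "\<exists>D. small_for (topspace W) D \<and> (\<forall>a\<in>A - D. z2 a b \<in> coboundaries W n)"
    if b: "b \<in> B" for b
    unfolding z2_def
  proof (rule restrictions_cohomologous[OF _ _ _ h1])
    fix w N assume w: "w \<in> topspace W" and N: "openin X N" "j None (Some b) w \<in> N"
    have "continuous_map (one_point A) X (\<lambda>v. (w, v, Some b))"
      unfolding X_def using w b
      by (intro continuous_map_pairedI continuous_map_into_plank) auto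
    from openin_continuous_map_preimage[OF this N(1)] N(2)
    show "finite {a \<in> A. j (Some a) (Some b) w \<notin> N}"
      by (auto simp: openin_one_point j_def elim: rev_finite_subset)
  qed (use b j in \<open>auto simp: topspace_plank V1_def j_def X_def\<close>)
  obtain E where E: "\<And>a. a \<in> A \<Longrightarrow> small_for (topspace W) (E a)"
    "\<And>a b. a \<in> A \<Longrightarrow> b \<in> B - E a \<Longrightarrow> h2 a b \<in> coboundaries W n"
    using horizontal by metis
  obtain D where D: "\<And>b. b \<in> B \<Longrightarrow> small_for (topspace W) (D b)"
    "\<And>a b. b \<in> B \<Longrightarrow> a \<in> A - D b \<Longrightarrow> z2 a b \<in> coboundaries W n"
    using vertical by metis
  \<comment> \<open>First \<open>b\<close> and \<open>b'\<close> are chosen to work for all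
    \<open>a \<in> A\<close> at once: \<open>|A|\<close> many sets smaller than \<open>A\<close>
    have a union of size at most \<open>|A|\<close>. Then \<open>a\<close> and \<open>a'\<close>
    need only avoid two sets smaller than \<open>A\<close>.\<close>
  have "|\<Union>a\<in>A. E a| \<le>o |A|"
    using card_of_UNION_ordLeq_infinite[OF A(1) card_of_mono1[OF subset_refl], of E]
      small_for_ordLess[OF E(1) A(2,1)] ordLess_imp_ordLeq by blast
  with f obtain b b' where b: "b \<in> B - (\<Union>a\<in>A. E a)" "b' \<in> B - (\<Union>a\<in>A. E a)"
    and bb': "\<And>D. |D| <o |A| \<Longrightarrow>
      \<exists>a\<in>A - D. \<exists>a'\<in>A - D. f a b - f a b' - f a' b + f a' b' dvd 1"
    unfolding unit_mixed_difference_def by meson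
  have "|D b \<union> D b'| <o |A|"
    using small_for_ordLess[OF D(1) A(2,1)] b by (intro card_of_Un_ordLess_infinite A(1)) auto
  from bb'[OF this] obtain a a' where a: "a \<in> A - (D b \<union> D b')" "a' \<in> A - (D b \<union> D b')"
    and unit: "f a b - f a b' - f a' b + f a' b' dvd 1"
    by blast
  have h2: "h2 a b \<in> coboundaries W n" "h2 a b' \<in> coboundaries W n"
      "h2 a' b \<in> coboundaries W n" "h2 a' b' \<in> coboundaries W n"
    using a b by (auto intro!: E(2))
  have z2: "z2 a b \<in> coboundaries W n" "z2 a b' \<in> coboundaries W n"
      "z2 a' b \<in> coboundaries W n" "z2 a' b' \<in> coboundaries W n"
    using a b by (auto intro!: D(2))
  obtain r where r: "(f a b - f a b' - f a' b + f a' b') * r = 1"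
    using unit by (auto elim: dvdE)
  have "c \<in> coboundaries W n"
  proof (rule coboundaries_cong')
    \<comment> \<open>All terms from slices with a coordinate \<open>None\<close> cancel. What
      remains is the mixed difference of \<open>h - z\<close>, that is, \<open>(-1) ^ n\<close>
      times \<open>c\<close> times a unit with inverse \<open>r\<close>.\<close>
    show "(\<lambda>ws. r * (-1) ^ n * (((h2 a b ws - h2 a b' ws) - (h2 a' b ws - h2 a' b' ws))
        - ((z2 a b ws - z2 a b' ws) - (z2 a' b ws - z2 a' b' ws)))) \<in> coboundaries W n"
      by (intro coboundaries_scale coboundaries_diff h2 z2)
    fix ws :: "'w list" assume ws: "length ws = Suc n"
    have cup: "cup_cochain n ?c ?F (map (j u v) ws) = c ws * plank_fun f (u, v)" for u v
      using ws by (simp add: cup_cochain_def j_def o_def)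
    have "((h2 a b ws - h2 a b' ws) - (h2 a' b ws - h2 a' b' ws))
        - ((z2 a b ws - z2 a b' ws) - (z2 a' b ws - z2 a' b' ws))
      = (-1) ^ n * (c ws * (f a b - f a b' - f a' b + f a' b'))"
      unfolding h2_def z2_def z_def cup by (simp add: plank_fun_def algebra_simps)
    then have "r * (-1) ^ n * (((h2 a b ws - h2 a b' ws) - (h2 a' b ws - h2 a' b' ws))
        - ((z2 a b ws - z2 a b' ws) - (z2 a' b ws - z2 a' b' ws)))
      = ((-1) ^ n * (-1) ^ n) * (c ws * ((f a b - f a b' - f a' b + f a' b') * r))"
      by (simp only: ac_simps)
    then show "c ws = r * (-1) ^ n * (((h2 a b ws - h2 a b' ws) - (h2 a' b ws - h2 a' b' ws))
        - ((z2 a b ws - z2 a b' ws) - (z2 a' b ws - z2 a' b' ws)))"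
      by (simp only: r) (simp add: power_add[symmetric] mult_2[symmetric])
  qed
  with c(2) show False ..
qed


section \<open>Products of planks\<close>

text \<open>Transport of structure puts each product of planks back on a subset of the original
  type, so that an induction on the number of planks can be stated.\<close>

lemma homeomorphic_copy:
  assumes "|S| =o |topspace X|"
  obtains Y g where "topspace Y = S" "homeomorphic_map Y X g"
proof -
  obtain g where g: "bij_betw g S (topspace X)"
    using assms card_of_ordIso by blast
  define Y where "Y = pullback_topology S g X"
  have Y: "topspace Y = S"
    using g by (auto simp: Y_def topspace_pullback_topology bij_betw_def)
  moreover have "homeomorphic_map Y X g"
  proof (rule bijective_open_imp_homeomorphic_map)
    show "continuous_map Y X g"
      using continuous_map_pullback[OF continuous_map_id] by (simp add: Y_def)
    show "open_map Y X g"
      unfolding open_map_def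
    proof (intro allI impI)
      fix U assume "openin Y U"
      then obtain V where V: "openin X V" "U = g -` V \<inter> S"
        unfolding Y_def openin_pullback_topology by blast
      then have "V \<subseteq> g ` S"
        using openin_subset[OF V(1)] g by (simp add: bij_betw_def)
      then have "g ` U = V"
        using V(2) by blast
      with V show "openin X (g ` U)" by simp
    qed
  qed (use g Y in \<open>auto simp: bij_betw_def\<close>)
  ultimately show thesis
    by (rule that)
qed

lemma coboundaries_homeomorphic_map:
  assumes g: "homeomorphic_map X Y g" and f: "f \<circ> map g \<in> coboundaries X n"
  shows "f \<in> coboundaries Y n"
proof -
  obtain g' where g': "continuous_map Y X g'" "\<And>y. y \<in> topspace Y \<Longrightarrow> g (g' y) = y"
    using g unfolding homeomorphic_map_maps homeomorphic_maps_def by blast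
  show ?thesis
  proof (rule coboundaries_cong'[OF coboundaries_pullback[OF g'(1) f]])
    fix ys assume "set ys \<subseteq> topspace Y"
    then have "map (g \<circ> g') ys = ys"
      using g'(2) by (intro map_idI) auto
    then show "f ys = (f \<circ> map g \<circ> map g') ys"
      by simp
  qed
qed

lemma card_of_prod_plank:
  assumes "W \<noteq> {}" "infinite A" "|W| <o |A|" "|A| \<le>o |B|"
  shows "|W \<times> topspace (plank A B)| =o |B|"
proof -
  have B: "infinite B"
    using assms(2,4) card_of_ordLeq_infinite by blast
  obtain w a where wa: "w \<in> W" "a \<in> A"
    using assms(1,2) by (metis ex_in_conv finite.emptyI)
  have opt: "|insert None (Some ` C)| \<le>o |B|" if "|C| \<le>o |B|" for C :: "'x set"
  proof -
    have "|Some ` C| \<le>o |B|"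
      using card_of_image ordLeq_transitive that by blast
    moreover have "|{None}| \<le>o |B|"
      using B by (metis card_of_singl_ordLeq finite.emptyI)
    ultimately have "|{None} \<union> Some ` C| \<le>o |B|"
      using B card_of_Card_order[of B]
      by (intro card_of_Un_ordLeq_infinite_Field) (auto simp: Field_card_of)
    then show ?thesis by simp
  qed
  have "|insert None (Some ` A) \<times> insert None (Some ` B)| \<le>o |B|"
    using opt[OF assms(4)] opt[of B] B card_of_Card_order[of B] card_of_mono1[of B B]
    by (intro card_of_Times_ordLeq_infinite_Field) (auto simp: Field_card_of)
  then have "|topspace (plank A B)| \<le>o |B|"
    unfolding topspace_plank using card_of_mono1[OF Diff_subset] ordLeq_transitive by blast
  moreover have "|W| \<le>o |B|"
    using assms(3,4) ordLess_imp_ordLeq ordLeq_transitive by blast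
  ultimately have "|W \<times> topspace (plank A B)| \<le>o |B|"
    using B card_of_Card_order[of B]
    by (intro card_of_Times_ordLeq_infinite_Field) (auto simp: Field_card_of)
  moreover have "|B| \<le>o |W \<times> topspace (plank A B)|"
  proof -
    have "inj_on (\<lambda>b. (w, Some a, Some b)) B"
      "(\<lambda>b. (w, Some a, Some b)) ` B \<subseteq> W \<times> topspace (plank A B)"
      using wa by (auto simp: inj_on_def topspace_plank)
    then show ?thesis
      using card_of_ordLeq by blast
  qed
  ultimately show ?thesis
    by (simp add: ordIso_iff_ordLeq)
qed

text \<open>\<open>S\<close> has two roles: it indexes the second factor of the plank, and, being
  equipotent to the product of \<open>W\<close> with the plank, it carries the resulting
  space.\<close>

lemma attach_plank:
  fixes W :: "'w topology" and S A :: "'a set" and c :: "'w list \<Rightarrow> 'r::comm_ring_1"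
  assumes W: "locally_compact_zero_dim W"
    and c: "c \<in> cocycles W n" "c \<notin> coboundaries W n"
    and A: "infinite A" "|topspace W| <o |A|" and S: "|S| =o cardSuc |A|"
  obtains U :: "'a topology" and p e where
    "locally_compact_zero_dim U" "topspace U = S" "continuous_map U W p" "e \<in> cocycles U 1"
    "cup_cochain n (c \<circ> map p) e \<notin> coboundaries U (Suc n)"
proof -
  obtain f :: "'a \<Rightarrow> 'a \<Rightarrow> 'r" where f: "unit_mixed_difference A S f"
    using exists_unit_mixed_difference[OF A(1) S] by blast
  let ?X = "prod_topology W (plank A S)"
  have "topspace W \<noteq> {}"
  proof
    assume "topspace W = {}"
    then have "c \<in> coboundaries W n"
      by (cases n) (auto simp: coboundaries_def godement_pow_Suc)
    with c(2) show False ..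
  qed
  moreover have "|A| \<le>o |S|"
    using cardSuc_ordLeq[OF card_of_Card_order] S ordIso_symmetric ordLeq_ordIso_trans by blast
  ultimately have "|S| =o |topspace ?X|"
    using card_of_prod_plank[OF _ A] ordIso_symmetric by (metis topspace_prod_topology)
  then obtain U and g where U: "topspace U = S" and g: "homeomorphic_map U ?X g"
    by (rule homeomorphic_copy)
  note g_cont = homeomorphic_imp_continuous_map[OF g]
  show thesis
  proof (rule that[of U "fst \<circ> g" "plank_cocycle f \<circ> map snd \<circ> map g"])
    have "?X homeomorphic_space U"
      using homeomorphic_map_imp_homeomorphic_space[OF g] homeomorphic_space_sym by blast
    then show "locally_compact_zero_dim U"
      by (rule locally_compact_zero_dim_homeomorphic_space)
        (intro locally_compact_zero_dim_prod_topology W locally_compact_zero_dim_plank)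
    show "topspace U = S" by (rule U)
    show "continuous_map U W (fst \<circ> g)"
      using g_cont continuous_map_fst by (rule continuous_map_compose)
    show "plank_cocycle f \<circ> map snd \<circ> map g \<in> cocycles U 1"
      by (intro cocycles_pullback[OF g_cont] cocycles_pullback[OF continuous_map_snd] plank_cocycle)
    have "cup_cochain n (c \<circ> map (fst \<circ> g)) (plank_cocycle f \<circ> map snd \<circ> map g) =
        cup_cochain n (c \<circ> map fst) (plank_cocycle f \<circ> map snd) \<circ> map g"
      by (simp add: cup_cochain_map o_assoc[symmetric])
    then show "cup_cochain n (c \<circ> map (fst \<circ> g)) (plank_cocycle f \<circ> map snd \<circ> map g)
        \<notin> coboundaries U (Suc n)"
      using cup_plank_cocycle_not_coboundary[OF c A f] coboundaries_homeomorphic_map[OF g] by metis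
  qed
qed

section \<open>Iterated cup products and the induction on the number of planks\<close>

primrec cup_power :: "(nat \<Rightarrow> 'a list \<Rightarrow> 'r::comm_ring_1) \<Rightarrow> nat \<Rightarrow> 'a list \<Rightarrow> 'r" where
  "cup_power e 0 = e 0"
| "cup_power e (Suc n) = cup_cochain (Suc n) (cup_power e n) (e (Suc n))"

lemma cup_power_cong: "(\<And>i. i \<le> n \<Longrightarrow> e i = e' i) \<Longrightarrow> cup_power e n = cup_power e' n"
  by (induction n) simp_all

lemma cup_power_map: "cup_power (\<lambda>i. e i \<circ> map p) n = cup_power e n \<circ> map p"
proof (induction n)
  case (Suc n)
  show ?case
    unfolding cup_power.simps Suc.IH cup_cochain_map ..
qed simp

lemma cup_power_cocycles:
  assumes "\<And>i. i \<le> n \<Longrightarrow> e i \<in> cocycles X 1"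
  shows "cup_power e n \<in> cocycles X (Suc n)"
  using assms
proof (induction n)
  case (Suc n)
  then show ?case
    using cup_cochain_cocycles[of "cup_power e n" X "Suc n" "e (Suc n)" 1] by simp
qed simp

lemma cup_deg1_classes:
  assumes "\<And>i. i \<le> n \<Longrightarrow> e i \<in> cocycles X 1"
  shows "cup_deg1 X (\<lambda>i. cohomologous X 1 `` {e i}) n = cohomologous X (Suc n) `` {cup_power e n}"
  using assms
proof (induction n)
  case (Suc n)
  then show ?case
    using cup_class[OF cup_power_cocycles[of n e X] Suc.prems[of "Suc n"]] by simp
qed simp

lemma has_aleph_infinite: "has_aleph k A \<Longrightarrow> infinite A"
proof (induction k arbitrary: A)
  case 0
  then have "|UNIV :: nat set| =o |A|"
    using card_of_nat ordIso_symmetric ordIso_transitive has_aleph.simps(1) by blast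
  then show ?case
    using card_of_ordIso_finite infinite_UNIV_nat by blast
next
  case (Suc k)
  then show ?case
    using finite_subset by auto
qed

lemma exists_cup_power_not_coboundary:
  fixes S :: "'a set"
  assumes "has_aleph (2 * n + 1) S"
  shows "\<exists>(U :: 'a topology) (e :: nat \<Rightarrow> 'a list \<Rightarrow> 'r::comm_ring_1).
    locally_compact_zero_dim U \<and> topspace U = S \<and> (\<forall>i\<le>n. e i \<in> cocycles U 1) \<and>
    cup_power e n \<notin> coboundaries U (Suc n)"
  using assms
proof (induction n arbitrary: S)
  case 0
  then obtain A :: "'a set" where A: "has_aleph 0 A" "|S| =o cardSuc |A|"
    unfolding mult_0_right add_0 One_nat_def has_aleph.simps(2) by blast
  \<comment> \<open>The induction starts from a point and the class 1, which is nonzero because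
    coboundaries of degree 0 vanish; multiplication by it changes nothing.\<close>
  let ?W = "discrete_topology {()}" and ?c = "\<lambda>_. 1 :: 'r"
  have c: "?c \<in> cocycles ?W 0" "?c \<notin> coboundaries ?W 0"
    by (auto simp: cocycles_0_iff coboundaries_def godement_pow_Suc)
  have "|topspace ?W| <o |A|"
    using has_aleph_infinite[OF A(1)]
    by (intro finite_ordLess_infinite card_of_Well_order) (auto simp: Field_card_of)
  from attach_plank[OF locally_compact_zero_dim_discrete c has_aleph_infinite[OF A(1)] this A(2)]
  obtain U :: "'a topology" and p :: "'a \<Rightarrow> unit" and e where "locally_compact_zero_dim U" "topspace U = S"
      "e \<in> cocycles U 1" "cup_cochain 0 (?c \<circ> map p) e \<notin> coboundaries U (Suc 0)" .
  then show ?case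
    by (intro exI[of _ U] exI[of _ "\<lambda>_. e"]) (simp add: cup_cochain_def[abs_def])
next
  case (Suc n)
  then obtain A where A: "A \<subseteq> S" "has_aleph (Suc (2 * n + 1)) A" "|S| =o cardSuc |A|"
    by auto
  \<comment> \<open>\<open>T\<close>, \<open>A\<close>, \<open>S\<close> have consecutive
    cardinalities: \<open>T\<close> carries the previous space, \<open>A\<close> and
    \<open>S\<close> index the factors of the new plank. So each plank uses up two
    cardinals.\<close>
  then obtain T :: "'a set" where T: "has_aleph (2 * n + 1) T" "|A| =o cardSuc |T|"
    by auto
  from Suc.IH[OF T(1)] obtain W :: "'a topology" and e :: "nat \<Rightarrow> 'a list \<Rightarrow> 'r" where
    W: "locally_compact_zero_dim W" "topspace W = T" and e: "\<And>i. i \<le> n \<Longrightarrow> e i \<in> cocycles W 1"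
      "cup_power e n \<notin> coboundaries W (Suc n)"
    by blast
  have "|topspace W| <o |A|"
    using cardSuc_greater[OF card_of_Card_order] T(2) W(2) ordLess_ordIso_trans ordIso_symmetric
    by metis
  have "cup_power e n \<in> cocycles W (Suc n)"
    using e(1) by (rule cup_power_cocycles)
  from attach_plank[OF W(1) this e(2) has_aleph_infinite[OF A(2)] \<open>|topspace W| <o |A|\<close> A(3)]
  obtain U :: "'a topology" and p d where U: "locally_compact_zero_dim U" "topspace U = S"
      "continuous_map U W p" "d \<in> cocycles U 1"
      "cup_cochain (Suc n) (cup_power e n \<circ> map p) d \<notin> coboundaries U (Suc (Suc n))" .
  define e' where "e' i = (if i \<le> n then e i \<circ> map p else d)" for i
  have "cup_power e' n = cup_power e n \<circ> map p"
    using cup_power_cong[of n e' "\<lambda>i. e i \<circ> map p"] by (simp add: e'_def cup_power_map)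
  then have "cup_power e' (Suc n) \<notin> coboundaries U (Suc (Suc n))"
    using U(5) by (simp add: e'_def)
  moreover have "\<forall>i\<le>Suc n. e' i \<in> cocycles U 1"
    using U(3,4) e(1) by (auto simp: e'_def intro: cocycles_pullback)
  ultimately show ?case
    using U(1,2) by blast
qed

text \<open>The hypothesis asks that the type be large enough; iterating
  \<open>has_aleph_Suc_exists\<close> from \<open>has_aleph_UNIV_nat\<close> yields such a type for
  each fixed \<open>n\<close>.\<close>

theorem theoremC:
  fixes n :: nat
  assumes "\<exists>A :: 'a set. has_aleph (2 * n + 1) A"
  shows "\<exists>(U :: 'a topology) (\<eta> :: nat \<Rightarrow> ('a list \<Rightarrow> bit) set).
    locally_profinite_space U \<and>
    has_aleph (2 * n + 1) (topspace U) \<and>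
    (\<forall>i\<le>n. \<eta> i \<in> cohomology U 1) \<and>
    cup_deg1 U \<eta> n \<noteq> cohomology_zero U (n + 1)"
proof -
  obtain S :: "'a set" where S: "has_aleph (2 * n + 1) S"
    using assms by blast
  then obtain U :: "'a topology" and e :: "nat \<Rightarrow> 'a list \<Rightarrow> bit" where
    U: "locally_compact_zero_dim U" "topspace U = S" and e: "\<And>i. i \<le> n \<Longrightarrow> e i \<in> cocycles U 1"
      "cup_power e n \<notin> coboundaries U (Suc n)"
    using exists_cup_power_not_coboundary by blast
  let ?\<eta> = "\<lambda>i. cohomologous U 1 `` {e i}"
  have "cup_deg1 U ?\<eta> n = cohomologous U (Suc n) `` {cup_power e n}"
    using e(1) by (rule cup_deg1_classes)
  moreover have "cup_power e n \<in> cocycles U (Suc n)"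
    using e(1) by (rule cup_power_cocycles)
  \<comment> \<open>A class contains its representative, whereas the zero class consists of the
    coboundaries.\<close>
  ultimately have "cup_power e n \<in> cup_deg1 U ?\<eta> n"
    using equiv_class_self[OF equiv_cohomologous] by metis
  then have "cup_deg1 U ?\<eta> n \<noteq> cohomology_zero U (n + 1)"
    using e(2) by (auto simp: cohomology_zero_eq)
  moreover have "?\<eta> i \<in> cohomology U 1" if "i \<le> n" for i
    unfolding cohomology_def using e(1)[OF that] by (rule quotientI)
  ultimately show ?thesis
    using locally_compact_zero_dim_imp_locally_profinite_space[OF U(1)] S U(2)
    by (intro exI[of _ U] exI[of _ ?\<eta>]) auto
qed

end
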